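(* Let $1\le k\le n$ and let $V$ be a nontrivial, integral, free boundary stationary $k$-varifold in the unit ball $(B^n,\partial B^n)$, where $B^n\subset\mathbb{R}^n$ is the Euclidean unit ball. Then $$\mathbf{M}(V)\geq\operatorname{area}(B^k).$$ Moreover, if equality holds, then $\operatorname{spt}\|V\|$ is contained in a $k$-dimensional subspace of $\mathbb{R}^n$.
   Context: $\operatorname{area}(B^k)$ is the $k$-dimensional volume of the Euclidean unit ball $B^k\subset\mathbb{R}^k$. A $k$-varifold in $\mathbb{R}^n$ is a Radon measure on $\mathbb{R}^n\times\operatorname{Gr}(k,n)$, where $\operatorname{Gr}(k,n)$ is the Grassmannian of unoriented $k$-planes in $\mathbb{R}^n$; its weight $\|V\|$ is the pushforward measure on $\mathbb{R}^n$, its mass is $\mathbf{M}(V)=\|V\|(\mathbb{R}^n)$, and $\operatorname{spt}\|V\|$ is the support of the weight. $V$ is integral if it is an integer rectifiable varifold. A $k$-varifold in $B^n$ is one with $\operatorname{spt}\|V\|\subset\overline{B^n}$. An integral $k$-varifold $V$ in $B^n$ is free boundary stationary in $(B^n,\partial B^n)$ if $$\int\operatorname{div}_S X(x)\,dV(x,S)=0$$ for every smooth vector field $X$ on $\mathbb{R}^n$ with $X(p)\in T_p\partial B^n$ for all $p\in\partial B^n$, where $\operatorname{div}_S X(x)=\sum_{i=1}^k\langle D_{e_i}X(x),e_i\rangle$ for an orthonormal basis $(e_i)$ of $S$. "Nontrivial" means $V\ne0$. *)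

theory Defs
  imports "HOL-Analysis.Analysis"
begin

section \<open>Hausdorff measure\<close>

text \<open>
  The normalisation is the usual one, under which the \<open>k\<close>-dimensional Hausdorff measure agrees with
  Lebesgue measure on \<open>k\<close>-planes. Covers consist of bounded sets because \<^const>\<open>diameter\<close> has no
  meaningful value on unbounded ones. The definition is meant for \<open>k \<ge> 1\<close> (for \<open>k = 0\<close> empty members
  of a cover would be counted, as \<open>0 ^ 0 = 1\<close>).
\<close>

definition hausdorff_pre :: "nat \<Rightarrow> real \<Rightarrow> 'a::euclidean_space set \<Rightarrow> ennreal" where
  "hausdorff_pre k \<delta> A =
     (INF C\<in>{C :: nat \<Rightarrow> 'a set. A \<subseteq> (\<Union>i. C i) \<and> (\<forall>i. bounded (C i) \<and> diameter (C i) < \<delta>)}.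
        \<Sum>i. ennreal (unit_ball_vol (real k) * (diameter (C i) / 2) ^ k))"

definition hausdorff_outer :: "nat \<Rightarrow> 'a::euclidean_space set \<Rightarrow> ennreal" where
  "hausdorff_outer k A = (SUP \<delta>\<in>{0<..}. hausdorff_pre k \<delta> A)"

text \<open>The Hausdorff measure lives on the Caratheodory-measurable sets.\<close>

definition hausdorff :: "nat \<Rightarrow> 'a::euclidean_space measure" where
  "hausdorff k =
     measure_of UNIV (lambda_system UNIV (Pow UNIV) (hausdorff_outer k)) (hausdorff_outer k)"

lemma hausdorff_pre_mono: "A \<subseteq> B \<Longrightarrow> hausdorff_pre k \<delta> A \<le> hausdorff_pre k \<delta> B"
  unfolding hausdorff_pre_def by (rule INF_superset_mono) auto

lemma hausdorff_outer_mono: "A \<subseteq> B \<Longrightarrow> hausdorff_outer k A \<le> hausdorff_outer k B"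
  unfolding hausdorff_outer_def by (intro SUP_mono') (rule hausdorff_pre_mono)

lemma hausdorff_outer_empty:
  assumes "1 \<le> k"
  shows "hausdorff_outer k {} = 0"
proof -
  have "hausdorff_pre k \<delta> ({} :: 'a set) = 0" if "\<delta> > 0" for \<delta>
  proof -
    have "hausdorff_pre k \<delta> ({} :: 'a set)
        \<le> (\<Sum>i::nat. ennreal (unit_ball_vol (real k) * (diameter ({} :: 'a set) / 2) ^ k))"
      unfolding hausdorff_pre_def by (rule INF_lower) (use that in auto)
    also have "\<dots> = 0"
      using assms by (simp add: power_0_left)
    finally show ?thesis by simp
  qed
  then show ?thesis
    unfolding hausdorff_outer_def by (simp add: SUP_eq_const)
qed

lemma hausdorff_pre_subadditive:
  fixes A :: "nat \<Rightarrow> 'a::euclidean_space set"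
  shows "hausdorff_pre k \<delta> (\<Union>i. A i) \<le> (\<Sum>n. hausdorff_pre k \<delta> (A n))"
proof (rule ennreal_le_epsilon)
  let ?f = "\<lambda>C :: 'a set. ennreal (unit_ball_vol (real k) * (diameter C / 2) ^ k)"
  let ?H = "hausdorff_pre k \<delta>"
  fix e :: real assume "0 < e" "(\<Sum>n. ?H (A n)) < top"
  then have *: "\<And>n. ?H (A n) < ?H (A n) + e * (1/2)^Suc n"
    by (auto simp add: less_top dest!: ennreal_suminf_lessD)
  have "\<exists>C. A n \<subseteq> (\<Union>i. C i) \<and> (\<forall>i::nat. bounded (C i) \<and> diameter (C i) < \<delta>) \<and>
             (\<Sum>i. ?f (C i)) < ?H (A n) + e * (1/2)^Suc n" for n
    using *[of n] unfolding hausdorff_pre_def[of k \<delta> "A n"] INF_less_iff by auto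
  then obtain B where sub: "\<And>n. A n \<subseteq> (\<Union>i. B n i)"
    and B: "\<And>n i::nat. bounded (B n i) \<and> diameter (B n i) < \<delta>"
    and le: "\<And>n. (\<Sum>i. ?f (B n i)) < ?H (A n) + e * (1/2)^Suc n"
    by metis
  define C where "C = case_prod B o prod_decode"
  have A_C: "(\<Union>i. A i) \<subseteq> (\<Union>i. C i)"
    using sub by (auto simp add: C_def subset_eq) (metis prod.case prod_encode_inverse)
  have "?H (\<Union>i. A i) \<le> (\<Sum>i. ?f (C i))"
    unfolding hausdorff_pre_def
    by (rule INF_lower) (use A_C B in \<open>auto simp: C_def split: prod.split\<close>)
  also have "\<dots> = (\<Sum>n. \<Sum>i. ?f (B n i))"
    unfolding C_def comp_def by (intro suminf_ennreal_2dimen) auto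
  also have "\<dots> \<le> (\<Sum>n. ?H (A n) + e * (1/2) ^ Suc n)"
    by (intro suminf_le allI less_imp_le[OF le]) auto
  also have "\<dots> = (\<Sum>n. ?H (A n)) + (\<Sum>n. ennreal e * ennreal ((1/2) ^ Suc n))"
    using \<open>0 < e\<close> by (subst suminf_add[symmetric])
                     (auto simp del: ennreal_suminf_cmult simp add: ennreal_mult[symmetric])
  also have "\<dots> = (\<Sum>n. ?H (A n)) + e"
    unfolding ennreal_suminf_cmult
    by (subst suminf_ennreal_eq[OF zero_le_power power_half_series]) auto
  finally show "?H (\<Union>i. A i) \<le> (\<Sum>n. ?H (A n)) + e" .
qed

lemma outer_measure_space_hausdorff_outer:
  assumes "1 \<le> k"
  shows "outer_measure_space (Pow UNIV) (hausdorff_outer k)"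
proof -
  have "hausdorff_outer k (\<Union>i. A i) \<le> (\<Sum>n. hausdorff_outer k (A n))"
    for A :: "nat \<Rightarrow> 'a set"
    unfolding hausdorff_outer_def[of k "\<Union>i. A i"]
  proof (rule SUP_least)
    fix \<delta> :: real assume "\<delta> \<in> {0<..}"
    then have "hausdorff_pre k \<delta> (A n) \<le> hausdorff_outer k (A n)" for n
      unfolding hausdorff_outer_def by (rule SUP_upper)
    then show "hausdorff_pre k \<delta> (\<Union>i. A i) \<le> (\<Sum>n. hausdorff_outer k (A n))"
      by (intro order_trans[OF hausdorff_pre_subadditive] suminf_le) auto
  qed
  then show ?thesis
    using assms hausdorff_outer_mono
    by (auto simp: outer_measure_space_def positive_def increasing_def countably_subadditive_def
        hausdorff_outer_empty)
qed

lemma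
  fixes A :: "'a::euclidean_space set"
  assumes "1 \<le> k"
  shows sets_hausdorff:
      "sets (hausdorff k :: 'a measure) = lambda_system UNIV (Pow UNIV) (hausdorff_outer k)"
    and emeasure_hausdorff:
      "A \<in> sets (hausdorff k) \<Longrightarrow> emeasure (hausdorff k) A = hausdorff_outer k A"
proof -
  have ms: "measure_space UNIV (lambda_system UNIV (Pow UNIV) (hausdorff_outer k))
              (hausdorff_outer k :: 'a set \<Rightarrow> ennreal)"
    by (rule sigma_algebra.caratheodory_lemma[OF sigma_algebra_Pow
          outer_measure_space_hausdorff_outer[OF assms]])
  then show sets: "sets (hausdorff k :: 'a measure)
      = lambda_system UNIV (Pow UNIV) (hausdorff_outer k)"
    unfolding hausdorff_def measure_space_def by (intro sigma_algebra.sets_measure_of_eq) auto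
  show "emeasure (hausdorff k) A = hausdorff_outer k A" if "A \<in> sets (hausdorff k)"
    using ms that unfolding sets unfolding hausdorff_def measure_space_def
    by (intro emeasure_measure_of_sigma) auto
qed


section \<open>The Grassmannian\<close>

definition grassmannian :: "nat \<Rightarrow> 'a::euclidean_space set set" where
  "grassmannian k = {S. subspace S \<and> dim S = k}"

definition orthonormal_basis :: "'a::euclidean_space set \<Rightarrow> 'a set" where
  "orthonormal_basis S =
     (SOME B. B \<subseteq> S \<and> pairwise orthogonal B \<and> (\<forall>b\<in>B. norm b = 1) \<and> independent B \<and>
              card B = dim S \<and> span B = S)"

lemma orthonormal_basis:
  assumes "subspace S"
  shows "orthonormal_basis S \<subseteq> S" "pairwise orthogonal (orthonormal_basis S)"
    "\<forall>b\<in>orthonormal_basis S. norm b = 1" "independent (orthonormal_basis S)"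
    "card (orthonormal_basis S) = dim S" "span (orthonormal_basis S) = S"
proof -
  have "\<exists>B. B \<subseteq> S \<and> pairwise orthogonal B \<and> (\<forall>b\<in>B. norm b = 1) \<and> independent B \<and>
            card B = dim S \<and> span B = S"
    by (rule orthonormal_basis_subspace[OF assms]) blast
  from someI_ex[OF this] show "orthonormal_basis S \<subseteq> S" "pairwise orthogonal (orthonormal_basis S)"
    "\<forall>b\<in>orthonormal_basis S. norm b = 1" "independent (orthonormal_basis S)"
    "card (orthonormal_basis S) = dim S" "span (orthonormal_basis S) = S"
    unfolding orthonormal_basis_def by blast+
qed

definition plane_projection :: "'a::euclidean_space set \<Rightarrow> 'a \<Rightarrow>\<^sub>L 'a" where
  "plane_projection S = Blinfun (\<lambda>x. \<Sum>b\<in>orthonormal_basis S. (x \<bullet> b) *\<^sub>R b)"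

lemma plane_projection_apply:
  "blinfun_apply (plane_projection S) x = (\<Sum>b\<in>orthonormal_basis S. (x \<bullet> b) *\<^sub>R b)"
  unfolding plane_projection_def
  by (subst bounded_linear_Blinfun_apply) (auto intro!: bounded_linear_intros)

text \<open>The standard topology, induced by the distance \<open>norm (plane_projection S - plane_projection T)\<close>.\<close>

definition grassmannian_topology :: "nat \<Rightarrow> 'a::euclidean_space set topology" where
  "grassmannian_topology k = pullback_topology (grassmannian k) plane_projection euclidean"

text \<open>
  \<open>k\<close>-dimensional Lebesgue measure on the \<open>k\<close>-plane \<open>P\<close> (as a measure on the ambient space): the image
  of Lebesgue measure on \<open>\<real>\<^sup>k\<close> under an isometric parametrisation of \<open>P\<close>.
\<close>

definition plane_lborel :: "'a::euclidean_space set \<Rightarrow> 'a measure" where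
  "plane_lborel P =
     distr (\<Pi>\<^sub>M b\<in>orthonormal_basis P. lborel) borel (\<lambda>c. \<Sum>b\<in>orthonormal_basis P. c b *\<^sub>R b)"


section \<open>Varifolds\<close>

definition varifold_topology :: "nat \<Rightarrow> ('a::euclidean_space \<times> 'a set) topology" where
  "varifold_topology k = prod_topology euclidean (grassmannian_topology k)"

definition varifold_space :: "nat \<Rightarrow> ('a::euclidean_space \<times> 'a set) measure" where
  "varifold_space k = sigma (UNIV \<times> grassmannian k) {U. openin (varifold_topology k) U}"

lemma topspace_varifold_topology: "topspace (varifold_topology k) = UNIV \<times> grassmannian k"
  by (simp add: varifold_topology_def grassmannian_topology_def topspace_pullback_topology)

lemma
  shows space_varifold_space: "space (varifold_space k) = UNIV \<times> grassmannian k"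
    and sets_varifold_space:
      "sets (varifold_space k) = sigma_sets (UNIV \<times> grassmannian k) {U. openin (varifold_topology k) U}"
proof -
  have "{U. openin (varifold_topology k) U} \<subseteq> Pow (UNIV \<times> grassmannian k)"
    using openin_subset topspace_varifold_topology by blast
  from space_measure_of[OF this] sets_measure_of[OF this]
  show "space (varifold_space k) = UNIV \<times> grassmannian k"
    "sets (varifold_space k) = sigma_sets (UNIV \<times> grassmannian k) {U. openin (varifold_topology k) U}"
    unfolding varifold_space_def .
qed

lemma measurable_fst_varifold_space: "fst \<in> varifold_space k \<rightarrow>\<^sub>M borel"
proof (rule borel_measurableI)
  fix U :: "'a set" assume "open U"
  then have "openin (varifold_topology k) (U \<times> topspace (grassmannian_topology k))"
    unfolding varifold_topology_def by (intro openin_prod_Times_iff[THEN iffD2]) auto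
  moreover have "fst -` U \<inter> space (varifold_space k) = U \<times> topspace (grassmannian_topology k)"
    by (auto simp: space_varifold_space grassmannian_topology_def topspace_pullback_topology)
  ultimately show "fst -` U \<inter> space (varifold_space k) \<in> sets (varifold_space k)"
    by (simp add: sets_varifold_space sigma_sets.Basic)
qed

text \<open>
  A Radon measure, i.e. a Borel measure that is finite on compact sets; regularity is automatic, as
  the underlying space is locally compact, separable and metrisable.
\<close>

definition varifold :: "nat \<Rightarrow> ('a::euclidean_space \<times> 'a set) measure \<Rightarrow> bool" where
  "varifold k V \<longleftrightarrow> sets V = sets (varifold_space k) \<and>
     (\<forall>K. compactin (varifold_topology k) K \<longrightarrow> emeasure V K < \<infinity>)"

definition weight :: "('a::euclidean_space \<times> 'a set) measure \<Rightarrow> 'a measure" where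
  "weight V = distr V borel fst"

definition mass :: "('a::euclidean_space \<times> 'a set) measure \<Rightarrow> ennreal" where
  "mass V = emeasure (weight V) UNIV"

definition measure_support :: "'a::euclidean_space measure \<Rightarrow> 'a set" where
  "measure_support \<mu> = {x. \<forall>r>0. emeasure \<mu> (ball x r) > 0}"


section \<open>Integer rectifiable varifolds\<close>

text \<open>
  The sets below are those covered, up to a null set, by countably many Lipschitz images of \<open>\<real>\<^sup>k\<close>.
  As \<open>k\<close> is not a type, \<open>\<real>\<^sup>k\<close> is represented by a \<open>k\<close>-dimensional subspace \<open>E\<close>.
\<close>

definition countably_rectifiable :: "nat \<Rightarrow> 'a::euclidean_space set \<Rightarrow> bool" where
  "countably_rectifiable k M \<longleftrightarrow>
     (\<exists>E\<in>grassmannian k. \<exists>F :: nat \<Rightarrow> 'a \<Rightarrow> 'a.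
        (\<forall>j. \<exists>L. L-lipschitz_on E (F j)) \<and> hausdorff_outer k (M - (\<Union>j. F j ` E)) = 0)"

text \<open>
  The blow-ups of \<open>\<mu>\<close> at \<open>x\<close> converge vaguely to \<open>c\<close> times the area measure of \<open>P\<close>. For
  \<open>\<mu> = \<theta> \<H>\<^sup>k\<close> restricted to \<open>M\<close>, and \<open>c = \<theta> x\<close>, this says that \<open>P\<close> is the approximate tangent plane
  of \<open>M\<close> at \<open>x\<close> with respect to \<open>\<theta>\<close>.
\<close>

definition approx_tangent_plane ::
  "nat \<Rightarrow> 'a::euclidean_space measure \<Rightarrow> 'a \<Rightarrow> real \<Rightarrow> 'a set \<Rightarrow> bool" where
  "approx_tangent_plane k \<mu> x c P \<longleftrightarrow> P \<in> grassmannian k \<and>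
     (\<forall>f :: 'a \<Rightarrow> real. continuous_on UNIV f \<and> compact (closure {y. f y \<noteq> 0}) \<longrightarrow>
        ((\<lambda>r. (\<integral>y. f ((y - x) /\<^sub>R r) \<partial>\<mu>) / r ^ k) \<longlongrightarrow> c * (\<integral>y. f y \<partial>plane_lborel P)) (at_right 0))"

text \<open>
  \<open>V\<close> is the varifold of a countably rectifiable set \<open>M\<close> with positive integer multiplicity \<open>\<theta>\<close>: the
  image of \<open>\<theta> \<H>\<^sup>k\<close> restricted to \<open>M\<close> under \<open>x \<mapsto> (x, T\<^sub>x M)\<close>. Local integrability of \<open>\<theta>\<close> is part of
  \<open>varifold k V\<close>. The approximate tangent planes are determined almost everywhere; \<open>T\<close> picks an
  arbitrary \<open>k\<close>-plane on the remaining null set.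
\<close>

definition integral_varifold :: "nat \<Rightarrow> ('a::euclidean_space \<times> 'a set) measure \<Rightarrow> bool" where
  "integral_varifold k V \<longleftrightarrow> varifold k V \<and>
     (\<exists>(M :: 'a set) (\<theta> :: 'a \<Rightarrow> nat) (T :: 'a \<Rightarrow> 'a set).
        M \<in> sets (hausdorff k) \<and> countably_rectifiable k M \<and>
        (\<forall>x\<in>M. \<theta> x > 0) \<and>
        \<theta> \<in> restrict_space (hausdorff k) M \<rightarrow>\<^sub>M count_space UNIV \<and>
        (\<lambda>x. (x, T x)) \<in> restrict_space (hausdorff k) M \<rightarrow>\<^sub>M varifold_space k \<and>
        (let \<mu> = density (restrict_space (hausdorff k) M) (\<lambda>x. of_nat (\<theta> x)) in
           (AE x in \<mu>. approx_tangent_plane k \<mu> x (real (\<theta> x)) (T x)) \<and>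
           V = distr \<mu> (varifold_space k) (\<lambda>x. (x, T x))))"


section \<open>Free boundary stationarity in the unit ball\<close>

primrec times_differentiable ::
  "nat \<Rightarrow> ('a::euclidean_space \<Rightarrow> 'b::euclidean_space) \<Rightarrow> bool" where
  "times_differentiable 0 f \<longleftrightarrow> continuous_on UNIV f"
| "times_differentiable (Suc m) f \<longleftrightarrow> (\<forall>x. f differentiable at x) \<and>
     (\<forall>v. times_differentiable m (\<lambda>x. frechet_derivative f (at x) v))"

definition smooth :: "('a::euclidean_space \<Rightarrow> 'b::euclidean_space) \<Rightarrow> bool" where
  "smooth f \<longleftrightarrow> (\<forall>m. times_differentiable m f)"

definition plane_divergence :: "'a::euclidean_space set \<Rightarrow> ('a \<Rightarrow> 'a) \<Rightarrow> 'a \<Rightarrow> real" where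
  "plane_divergence S X x = (\<Sum>e\<in>orthonormal_basis S. frechet_derivative X (at x) e \<bullet> e)"

text \<open>The tangent space of the unit sphere at \<open>p\<close> is the orthogonal complement of \<open>p\<close>.\<close>

definition free_boundary_stationary :: "('a::euclidean_space \<times> 'a set) measure \<Rightarrow> bool" where
  "free_boundary_stationary V \<longleftrightarrow>
     (\<forall>X :: 'a \<Rightarrow> 'a. smooth X \<and> (\<forall>p\<in>sphere 0 1. X p \<bullet> p = 0) \<longrightarrow>
        (\<integral>(x, S). plane_divergence S X x \<partial>V) = 0)"

end

theory Submission
  imports Defs
begin

text \<open>
  The argument follows Brendle's proof of the sharp area bound for free boundary minimal surfaces.
  Fix a point \<open>y\<close> of the closed ball. The vector field
  \[ W(x) = x - \frac{x - y}{|x - y|^k} - \frac{|y|^2 x - y}{Q(x)^{k/2}}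
       - (k - 2) \int_0^1 \frac{t |y|^2 x - y}{Q(tx)^{k/2}} dt, \qquad
     Q(x) = |y|^2 |x|^2 - 2 \langle x, y \rangle + 1, \]
  is tangent to the sphere, because \<open>Q(x) = |x - y|\<^sup>2\<close> there. Along \<open>k\<close>-planes the first term has
  divergence \<open>k\<close>, and the fields subtracted from it have nonnegative divergence; the one with pole \<open>y\<close>
  contributes \<open>k |(x - y)\<^sup>\<bottom>|\<^sup>2 / |x - y|\<^bsup>k+2\<^esup>\<close> and an atom at \<open>y\<close> of mass \<open>k area(B\<^sup>k)\<close> times the density.
  If \<open>V\<close> has an approximate tangent plane at \<open>y\<close>, the density is at least \<open>1\<close> and the bound follows.
  In the equality case \<open>x - y\<close> lies in the tangent plane at \<open>x\<close> for almost all \<open>x\<close>, so the support lies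
  in an affine \<open>k\<close>-plane. If \<open>w\<close> is the point nearest to the origin of the affine hull of the support,
  then testing with \<open>w - \<langle>w, x\<rangle> x\<close> shows \<open>w = 0\<close>.

  Test fields have to be smooth on the whole space, so the power \<open>u\<^bsup>-k/2\<^esup>\<close> is truncated near \<open>0\<close> and
  replaced by a polynomial that is close to it in \<open>C\<^sup>2\<close>; the boundary condition is an algebraic identity
  that survives this. For \<open>y\<close> on the sphere the truncation makes the divergence of the integral term
  negative near \<open>y\<close>, an effect of lower order. For \<open>k = 1\<close> the integral term has the wrong sign and is
  replaced by another correction.
\<close>

section \<open>Smooth maps\<close>

lemma frechet_derivative_eqI:
  "(f has_derivative f') (at x) \<Longrightarrow> frechet_derivative f (at x) = f'"
  by (metis frechet_derivative_at)

lemma differentiable_has_frechet: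
  "f differentiable at x \<Longrightarrow> (f has_derivative frechet_derivative f (at x)) (at x)"
  by (simp add: frechet_derivative_works)

lemma times_differentiable_antimono:
  "times_differentiable (Suc m) f \<Longrightarrow> times_differentiable m f"
proof (induction m arbitrary: f)
  case 0
  then show ?case
    by (simp add: continuous_at_imp_continuous_on differentiable_imp_continuous_within)
qed auto

lemma times_differentiable_const: "times_differentiable m (\<lambda>x. c)"
  by (induction m arbitrary: c) auto

lemma times_differentiable_bounded_linear:
  assumes "bounded_linear f"
  shows "times_differentiable m f"
proof (cases m)
  case 0
  then show ?thesis using assms by (simp add: linear_continuous_on)
next
  case (Suc l)
  have "(f has_derivative f) (at x)" for x
    using assms by (rule bounded_linear_imp_has_derivative)
  then show ?thesis
    using Suc by (auto simp: times_differentiable_const frechet_derivative_eqI[of f f] differentiable_def)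
qed

lemma times_differentiable_add:
  "times_differentiable m f \<Longrightarrow> times_differentiable m g
    \<Longrightarrow> times_differentiable m (\<lambda>x. f x + g x)"
proof (induction m arbitrary: f g)
  case 0
  then show ?case by (simp add: continuous_on_add)
next
  case (Suc m)
  have D: "frechet_derivative (\<lambda>x. f x + g x) (at x)
      = (\<lambda>v. frechet_derivative f (at x) v + frechet_derivative g (at x) v)" for x
    using Suc.prems
    by (intro frechet_derivative_eqI has_derivative_add differentiable_has_frechet) auto
  show ?case
    using Suc by (auto simp: D)
qed

text \<open>The derivative of a bilinear product is a sum of two products of the same kind, so the
  induction on the order closes; undifferentiated factors enter it at the lower order. One product
  rule then serves scalar multiples, real products and inner products.\<close>

lemma times_differentiable_bilinear:
  fixes f :: "'d::euclidean_space \<Rightarrow> 'a::euclidean_space" and g :: "'d \<Rightarrow> 'b::euclidean_space"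
    and prod :: "'a \<Rightarrow> 'b \<Rightarrow> 'c::euclidean_space"
  assumes "bounded_bilinear prod"
  shows "times_differentiable m f \<Longrightarrow> times_differentiable m g
    \<Longrightarrow> times_differentiable m (\<lambda>x. prod (f x) (g x))"
proof (induction m arbitrary: f g)
  case 0
  then show ?case
    using bounded_bilinear.continuous_on[OF assms] by simp
next
  case (Suc m)
  have *: "((\<lambda>x. prod (f x) (g x)) has_derivative
      (\<lambda>v. prod (f x) (frechet_derivative g (at x) v) + prod (frechet_derivative f (at x) v) (g x))) (at x)" for x
    using Suc.prems
    by (intro bounded_bilinear.FDERIV[OF assms] differentiable_has_frechet) auto
  have "times_differentiable m f" "times_differentiable m g"
    using Suc.prems by (blast intro: times_differentiable_antimono)+
  then show ?case
    using Suc by (auto simp: frechet_derivative_eqI[OF *] differentiableI[OF *] intro!: times_differentiable_add)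
qed

lemma smooth_const: "smooth (\<lambda>x. c)"
  and smooth_bounded_linear: "bounded_linear f \<Longrightarrow> smooth f"
  and smooth_add: "smooth g \<Longrightarrow> smooth h \<Longrightarrow> smooth (\<lambda>x. g x + h x)"
  by (auto simp: smooth_def times_differentiable_const times_differentiable_bounded_linear
      times_differentiable_add)

lemma smooth_ident: "smooth (\<lambda>x. x)"
  by (simp add: smooth_bounded_linear)

lemma smooth_scaleR: "smooth f \<Longrightarrow> smooth g \<Longrightarrow> smooth (\<lambda>x. f x *\<^sub>R g x)"
  and smooth_mult: "smooth p \<Longrightarrow> smooth q \<Longrightarrow> smooth (\<lambda>x. p x * (q x :: real))"
  and smooth_inner: "smooth u \<Longrightarrow> smooth v \<Longrightarrow> smooth (\<lambda>x. u x \<bullet> v x)"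
  by (auto simp: smooth_def intro: times_differentiable_bilinear
      bounded_bilinear_scaleR bounded_bilinear_mult bounded_bilinear_inner)

lemma smooth_diff:
  assumes "smooth f" "smooth g"
  shows "smooth (\<lambda>x. f x - g x)"
  using smooth_add[OF assms(1) smooth_scaleR[OF smooth_const[of "-1"] assms(2)]] by simp

lemma smooth_power: "smooth f \<Longrightarrow> smooth (\<lambda>x. (f x :: real) ^ n)"
  by (induction n) (auto intro: smooth_const smooth_mult)

lemma smooth_poly: "smooth f \<Longrightarrow> smooth (\<lambda>x. poly p (f x :: real))"
  by (induction p) (auto intro: smooth_const smooth_mult smooth_add)

lemmas smooth_intros = smooth_const smooth_ident smooth_add smooth_diff smooth_scaleR smooth_mult
  smooth_inner smooth_power smooth_poly

lemma smooth_has_derivative: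
  "smooth f \<Longrightarrow> (f has_derivative frechet_derivative f (at x)) (at x)"
  unfolding smooth_def by (metis differentiable_has_frechet times_differentiable.simps(2))

lemma smooth_frechet_derivative: "smooth f \<Longrightarrow> smooth (\<lambda>x. frechet_derivative f (at x) v)"
  unfolding smooth_def by (metis times_differentiable.simps(2))

lemma smooth_continuous: "smooth f \<Longrightarrow> continuous_on UNIV f"
  unfolding smooth_def by (metis times_differentiable.simps(1))

text \<open>
  Polynomials in \<open>t\<close> with smooth coefficients: \<open>times_differentiable\<close> does not fit well with
  differentiation under the integral sign, but here the integral over \<open>t\<close> can be taken termwise.
\<close>

inductive poly_family :: "(real \<Rightarrow> 'a::euclidean_space \<Rightarrow> 'b::euclidean_space) \<Rightarrow> bool" where
  monom: "smooth a \<Longrightarrow> poly_family (\<lambda>t x. t ^ n *\<^sub>R a x)"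
| add: "poly_family f \<Longrightarrow> poly_family g \<Longrightarrow> poly_family (\<lambda>t x. f t x + g t x)"

lemma poly_family_smooth: "smooth a \<Longrightarrow> poly_family (\<lambda>t. a)"
  using poly_family.monom[of a 0] by simp

lemma poly_family_scaleR:
  assumes "poly_family f" "poly_family g"
  shows "poly_family (\<lambda>t x. f t x *\<^sub>R g t x)"
  using assms(1)
proof induction
  case (monom a n)
  show ?case
    using assms(2)
  proof induction
    case (monom b m)
    then show ?case
      using poly_family.monom[of "\<lambda>x. a x *\<^sub>R b x" "n + m"] \<open>smooth a\<close>
      by (simp add: power_add mult_ac smooth_scaleR)
  next
    case (add f g)
    then show ?case
      using poly_family.add by (fastforce simp: algebra_simps)
  qed
next
  case (add f g)
  then show ?case
    using poly_family.add by (fastforce simp: algebra_simps)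
qed

lemma poly_family_poly:
  assumes "poly_family f"
  shows "poly_family (\<lambda>t x. poly p (f t x :: real))"
proof (induction p)
  case 0
  show ?case by (simp add: poly_family_smooth smooth_const)
next
  case (pCons c p)
  show ?case
    using poly_family.add[OF poly_family_smooth[OF smooth_const[of c]] poly_family_scaleR[OF assms pCons(2)]]
    by simp
qed

text \<open>For a monomial the integral is a constant multiple of \<open>a\<close>, and sums follow
  by linearity. The continuity clauses in \<open>t\<close> belong to the induction because
  additivity of the integral needs integrable summands.\<close>

lemma poly_family_integral:
  fixes f :: "real \<Rightarrow> 'a::euclidean_space \<Rightarrow> 'b::euclidean_space"
  assumes "poly_family f"
  shows "smooth (\<lambda>x. integral {0..1} (\<lambda>t. f t x)) \<and>
    (\<forall>x. ((\<lambda>x. integral {0..1} (\<lambda>t. f t x)) has_derivative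
       (\<lambda>h. integral {0..1} (\<lambda>t. frechet_derivative (f t) (at x) h))) (at x)) \<and>
    (\<forall>t. smooth (f t)) \<and> (\<forall>x. continuous_on {0..1} (\<lambda>t. f t x)) \<and>
    (\<forall>x h. continuous_on {0..1} (\<lambda>t. frechet_derivative (f t) (at x) h))"
  using assms
proof induction
  case (monom a n)
  let ?c = "integral {0..1} (\<lambda>t::real. t ^ n)"
  have I: "integral {0..1} (\<lambda>t::real. t ^ n *\<^sub>R b) = ?c *\<^sub>R b" for b :: 'b
    by (intro integral_unique has_integral_scaleR_left integrable_integral
        integrable_continuous_interval continuous_intros)
  have D: "frechet_derivative (\<lambda>x. t ^ n *\<^sub>R a x) (at x)
      = (\<lambda>h. t ^ n *\<^sub>R frechet_derivative a (at x) h)" for t x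
    by (intro frechet_derivative_eqI has_derivative_scaleR_right smooth_has_derivative monom)
  show ?case
    unfolding D I
    using monom
    by (auto intro!: smooth_intros has_derivative_scaleR_right smooth_has_derivative continuous_intros)
next
  case (add f g)
  have D: "frechet_derivative (\<lambda>x. f t x + g t x) (at x)
      = (\<lambda>h. frechet_derivative (f t) (at x) h + frechet_derivative (g t) (at x) h)" for t x
    using add by (intro frechet_derivative_eqI has_derivative_add smooth_has_derivative) auto
  have I: "integral {0..1} (\<lambda>t. f t x + g t x)
      = integral {0..1} (\<lambda>t. f t x) + integral {0..1} (\<lambda>t. g t x)" for x
    using add by (intro Henstock_Kurzweil_Integration.integral_add integrable_continuous_interval) auto
  have J: "integral {0..1} (\<lambda>t. frechet_derivative (f t) (at x) h + frechet_derivative (g t) (at x) h)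
      = integral {0..1} (\<lambda>t. frechet_derivative (f t) (at x) h)
        + integral {0..1} (\<lambda>t. frechet_derivative (g t) (at x) h)" for x h
    using add by (intro Henstock_Kurzweil_Integration.integral_add integrable_continuous_interval) auto
  show ?case
    unfolding D I J using add
    by (auto intro!: smooth_intros has_derivative_add continuous_on_add)
qed

section \<open>Truncated powers and their polynomial approximation\<close>

text \<open>
  This is \<open>u\<^bsup>-a\<^esup>\<close> for \<open>u \<ge> \<rho>\<close>, continued below \<open>\<rho>\<close> by its second order Taylor polynomial at \<open>\<rho>\<close>.
\<close>

definition kern :: "real \<Rightarrow> real \<Rightarrow> real \<Rightarrow> real" where
  "kern a \<rho> u = (let m = max u \<rho> in
     m powr (- a - 2) * (m\<^sup>2 + a * m * (m - u) + a * (a + 1) / 2 * (m - u)\<^sup>2))"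

definition kern' :: "real \<Rightarrow> real \<Rightarrow> real \<Rightarrow> real" where
  "kern' a \<rho> u = (let m = max u \<rho> in - a * (m powr (- a - 2) * (m + (a + 1) * (m - u))))"

definition kern'' :: "real \<Rightarrow> real \<Rightarrow> real \<Rightarrow> real" where
  "kern'' a \<rho> u = a * (a + 1) * max u \<rho> powr (- a - 2)"

lemma has_derivative_split_at:
  fixes f g :: "real \<Rightarrow> real"
  assumes "\<And>x. x \<le> c \<Longrightarrow> (f has_real_derivative f' x) (at x)"
    and "\<And>x. c \<le> x \<Longrightarrow> (g has_real_derivative g' x) (at x)"
    and "f c = g c" "f' c = g' c"
  shows "((\<lambda>x. if x \<le> c then f x else g x) has_real_derivative (if x \<le> c then f' x else g' x)) (at x)"
proof -
  have "((\<lambda>x. if x \<in> {..c} then f x else g x) has_vector_derivative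
      (if x \<in> {..c} then f' x else g' x)) (at x within UNIV)"
    by (rule has_vector_derivative_If_within_closures[where T = "{c..}"])
       (use assms in \<open>auto simp flip: has_real_derivative_iff_has_vector_derivative
          intro: has_field_derivative_at_within\<close>)
  then show ?thesis
    by (simp add: has_real_derivative_iff_has_vector_derivative)
qed

lemma powr_shift:
  fixes x :: real
  assumes "0 < x"
  shows "x powr (- a) = x powr (- a - 2) * x\<^sup>2" and "x powr (- a - 1) = x powr (- a - 2) * x"
proof -
  have "x powr (- a) = x powr ((- a - 2) + 2)" "x powr (- a - 1) = x powr ((- a - 2) + 1)"
    by (rule arg_cong[of _ _ "(powr) x"], simp)+
  then show "x powr (- a) = x powr (- a - 2) * x\<^sup>2" "x powr (- a - 1) = x powr (- a - 2) * x"
    unfolding powr_add using assms by simp_all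
qed

context
  fixes a \<rho> :: real
  assumes a: "0 < a" and \<rho>: "0 < \<rho>"
begin

lemma DERIV_kern: "(kern a \<rho> has_real_derivative kern' a \<rho> u) (at u)"
proof -
  let ?c = "\<rho> powr (- a - 2)"
  have 1: "((\<lambda>u. ?c * (\<rho>\<^sup>2 + a * \<rho> * (\<rho> - u) + a * (a + 1) / 2 * (\<rho> - u)\<^sup>2)) has_real_derivative
      - a * (?c * (\<rho> + (a + 1) * (\<rho> - u)))) (at u)" for u
    by (auto intro!: derivative_eq_intros simp: field_simps)
  have 2: "((\<lambda>u. u powr (- a - 2) * u\<^sup>2) has_real_derivative - a * (u powr (- a - 2) * u)) (at u)"
    if "\<rho> \<le> u" for u
    using \<rho> that powr_add[of u "- a - 3" 1]
    by (auto intro!: derivative_eq_intros simp: algebra_simps power2_eq_square)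
  have "kern a \<rho> = (\<lambda>u. if u \<le> \<rho> then ?c * (\<rho>\<^sup>2 + a * \<rho> * (\<rho> - u) + a * (a + 1) / 2 * (\<rho> - u)\<^sup>2)
      else u powr (- a - 2) * u\<^sup>2)"
    by (auto simp: kern_def fun_eq_iff max_def)
  moreover have "kern' a \<rho> u = (if u \<le> \<rho> then - a * (?c * (\<rho> + (a + 1) * (\<rho> - u)))
      else - a * (u powr (- a - 2) * u))"
    by (auto simp: kern'_def max_def)
  ultimately show ?thesis
    using has_derivative_split_at[OF 1 2, of "\<rho>" u] by simp
qed

lemma DERIV_kern': "(kern' a \<rho> has_real_derivative kern'' a \<rho> u) (at u)"
proof -
  let ?c = "\<rho> powr (- a - 2)"
  have 1: "((\<lambda>u. - a * (?c * (\<rho> + (a + 1) * (\<rho> - u)))) has_real_derivative a * (a + 1) * ?c) (at u)" for u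
    by (auto intro!: derivative_eq_intros simp: field_simps)
  have 2: "((\<lambda>u. - a * (u powr (- a - 2) * u)) has_real_derivative a * (a + 1) * u powr (- a - 2)) (at u)"
    if "\<rho> \<le> u" for u
    using \<rho> that powr_add[of u "- a - 3" 1]
    by (auto intro!: derivative_eq_intros simp: algebra_simps power2_eq_square)
  have "kern' a \<rho> = (\<lambda>u. if u \<le> \<rho> then - a * (?c * (\<rho> + (a + 1) * (\<rho> - u)))
      else - a * (u powr (- a - 2) * u))"
    by (auto simp: kern'_def fun_eq_iff max_def)
  moreover have "kern'' a \<rho> u = (if u \<le> \<rho> then a * (a + 1) * ?c else a * (a + 1) * u powr (- a - 2))"
    by (auto simp: kern''_def max_def)
  ultimately show ?thesis
    using has_derivative_split_at[OF 1 2, of "\<rho>" u] by simp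
qed

text \<open>This is why the truncation is of second order: the Weierstrass theorem is applied to
  \<open>kern''\<close>, and the lower derivatives are then approximated by integration.\<close>

lemma continuous_kern'': "continuous_on S (kern'' a \<rho>)"
  using \<rho> unfolding kern''_def by (intro continuous_intros) auto

lemma kern'_le: "kern' a \<rho> u \<le> - a * max u \<rho> powr (- a - 1)"
proof -
  define m where "m = max u \<rho>"
  have m: "m > 0" "m \<ge> u" using \<rho> by (auto simp: m_def)
  have "m powr (- a - 1) = m powr (- a - 2) * m"
    using m(1) by (rule powr_shift)
  moreover have "0 \<le> a * (m powr (- a - 2) * ((a + 1) * (m - u)))"
    using m a by simp
  ultimately show ?thesis
    unfolding kern'_def Let_def m_def[symmetric] by (simp add: algebra_simps)
qed

lemma kern'_nonpos: "kern' a \<rho> u \<le> 0"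
  using kern'_le[of u] a by (meson mult_nonneg_nonneg mult_nonpos_nonneg neg_le_0_iff_le order.strict_implies_order order.trans powr_ge_zero)

text \<open>The squared distance of two points of the closed unit ball is at most 4. The strictly
  negative bound later yields the positive coefficient of the perpendicular part, on which the
  equality case rests.\<close>

lemma kern'_le_4:
  assumes "u \<le> 4" "\<rho> \<le> 4"
  shows "kern' a \<rho> u \<le> - a * 4 powr (- a - 1)"
proof -
  have "4 powr (- a - 1) \<le> max u \<rho> powr (- a - 1)"
    using assms a \<rho> by (intro powr_mono2') auto
  then have "a * 4 powr (- a - 1) \<le> a * max u \<rho> powr (- a - 1)"
    using a by (intro mult_left_mono) auto
  then show ?thesis using kern'_le[of u] by simp
qed

text \<open>For \<open>a = k / 2\<close>, twice the left-hand side is the divergence of the field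
  kern(|z|^2) z along a \<open>k\<close>-plane containing z, where \<open>u\<close> is |z|^2. Above
  \<rho> it vanishes, as the kernel is homogeneous of degree \<open>- a\<close> there; the Taylor
  continuation leaves a squared bump, which acts as an approximate delta at the pole.\<close>

lemma kern_flux:
  "a * kern a \<rho> u + u * kern' a \<rho> u =
     a * ((a + 1) * (a + 2) / 2) * (\<rho> powr (- a) * (max 0 (1 - u / \<rho>))\<^sup>2)"
proof (cases "u \<le> \<rho>")
  case True
  then have "max 0 (1 - u / \<rho>) = (\<rho> - u) / \<rho>"
    using \<rho> by (simp add: field_simps)
  moreover have "\<rho> powr (- a) = \<rho> powr (- a - 2) * \<rho>\<^sup>2"
    using \<rho> by (rule powr_shift)
  ultimately have "\<rho> powr (- a) * (max 0 (1 - u / \<rho>))\<^sup>2 = \<rho> powr (- a - 2) * (\<rho> - u)\<^sup>2"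
    using \<rho> by (simp add: power_divide)
  moreover have "a * (c * (\<rho>\<^sup>2 + a * \<rho> * (\<rho> - u) + a * (a + 1) / 2 * (\<rho> - u)\<^sup>2))
      + u * (- a * (c * (\<rho> + (a + 1) * (\<rho> - u)))) = a * ((a + 1) * (a + 2) / 2) * (c * (\<rho> - u)\<^sup>2)" for c
    by (simp add: field_simps power2_eq_square)
  ultimately show ?thesis
    unfolding kern_def kern'_def Let_def max_absorb2[OF True] by simp
next
  case False
  then show ?thesis
    using \<rho> by (simp add: kern_def kern'_def max_def field_simps power2_eq_square)
qed

lemma kern_at_1: "\<rho> < 1 \<Longrightarrow> kern a \<rho> 1 = 1"
  by (simp add: kern_def)

lemma kern_nonneg: "0 \<le> kern a \<rho> u"
  unfolding kern_def Let_def using a \<rho> by auto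

text \<open>The left-hand sides below are the first two derivatives of \<open>u * kern a \<rho> u\<close>.\<close>

lemma kern_outer:
  assumes "\<rho> \<le> u"
  shows "kern a \<rho> u + u * kern' a \<rho> u = (1 - a) * u powr (- a)"
    and "2 * kern' a \<rho> u + u * kern'' a \<rho> u = a * (a - 1) * u powr (- a - 1)"
proof -
  have "u powr (- a) = u powr (- a - 2) * u\<^sup>2" "u powr (- a - 1) = u powr (- a - 2) * u"
    using \<rho> assms by (intro powr_shift; simp)+
  then show "kern a \<rho> u + u * kern' a \<rho> u = (1 - a) * u powr (- a)"
    and "2 * kern' a \<rho> u + u * kern'' a \<rho> u = a * (a - 1) * u powr (- a - 1)"
    using assms by (simp_all add: kern_def kern'_def kern''_def max_def field_simps power2_eq_square)
qed

text \<open>The substitution \<open>u = s * \<rho>\<close> reduces both bounds to polynomials in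
  \<open>s\<close> on the unit interval. Only the order in \<rho> matters later. The second bound
  carries the weight \<open>u\<close> because in \<open>radial_term\<close> the expression is
  multiplied by a factor of at most \<open>u\<close>.\<close>

lemma kern_inner:
  assumes "0 \<le> u" "u \<le> \<rho>"
  shows "\<bar>kern a \<rho> u + u * kern' a \<rho> u\<bar> \<le> (1 + 2 * a)\<^sup>2 * \<rho> powr (- a)"
    and "u * \<bar>2 * kern' a \<rho> u + u * kern'' a \<rho> u\<bar> \<le> 4 * (1 + 2 * a)\<^sup>2 * \<rho> powr (- a)"
proof -
  define c where "c = \<rho> powr (- a - 2)"
  have c: "c \<ge> 0" by (simp add: c_def)
  have p: "\<rho> powr (- a) = c * \<rho>\<^sup>2"
    unfolding c_def using \<rho> by (rule powr_shift)
  obtain s where s: "u = s * \<rho>" "0 \<le> s" "s \<le> 1"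
    using assms \<rho> by (metis divide_le_eq_1_pos divide_nonneg_pos nonzero_divide_eq_eq less_numeral_extra(3))
  have k: "kern a \<rho> u = c * \<rho>\<^sup>2 * (1 + a * (1 - s) + a * (a + 1) / 2 * (1 - s)\<^sup>2)"
    "u * kern' a \<rho> u = - (c * \<rho>\<^sup>2 * (a * s * (1 + (a + 1) * (1 - s))))"
    "u * (u * kern'' a \<rho> u) = c * \<rho>\<^sup>2 * (a * (a + 1) * s\<^sup>2)"
    using assms by (auto simp: kern_def kern'_def kern''_def max_def c_def[symmetric] s(1) power2_eq_square algebra_simps add_divide_distrib)
  have b1: "0 \<le> 1 + a * (1 - s) + a * (a + 1) / 2 * (1 - s)\<^sup>2"
    using a s by simp
  have ss: "(1 - s)\<^sup>2 \<le> 1" "s\<^sup>2 \<le> 1" using s by (auto simp: power_le_one)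
  have b2: "1 + a * (1 - s) + a * (a + 1) / 2 * (1 - s)\<^sup>2 \<le> 1 + a * 1 + a * (a + 1) / 2 * 1"
    using a s ss by (intro add_mono mult_left_mono) auto
  have b3: "0 \<le> a * s * (1 + (a + 1) * (1 - s))" using a s by simp
  have b4: "a * s * (1 + (a + 1) * (1 - s)) \<le> a * 1 * (1 + (a + 1) * 1)"
    using a s by (intro add_mono mult_mono) auto
  have b5: "0 \<le> a * (a + 1) * s\<^sup>2" "a * (a + 1) * s\<^sup>2 \<le> a * (a + 1) * 1"
    using a ss by (auto intro: mult_left_mono simp del: mult_1_right)
  have "\<bar>1 + a * (1 - s) + a * (a + 1) / 2 * (1 - s)\<^sup>2 - a * s * (1 + (a + 1) * (1 - s))\<bar> \<le> (1 + 2 * a)\<^sup>2"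
  proof -
    have "1 + a * 1 + a * (a + 1) / 2 * 1 \<le> (1 + 2 * a)\<^sup>2" "a * 1 * (1 + (a + 1) * 1) \<le> (1 + 2 * a)\<^sup>2"
      using a by (auto simp: power2_eq_square algebra_simps)
    then show ?thesis using b1 b2 b3 b4 by linarith
  qed
  then have "c * \<rho>\<^sup>2 * \<bar>1 + a * (1 - s) + a * (a + 1) / 2 * (1 - s)\<^sup>2 - a * s * (1 + (a + 1) * (1 - s))\<bar>
      \<le> c * \<rho>\<^sup>2 * (1 + 2 * a)\<^sup>2"
    using c by (intro mult_left_mono) auto
  also have "c * \<rho>\<^sup>2 * \<bar>1 + a * (1 - s) + a * (a + 1) / 2 * (1 - s)\<^sup>2 - a * s * (1 + (a + 1) * (1 - s))\<bar>
      = \<bar>c * \<rho>\<^sup>2 * (1 + a * (1 - s) + a * (a + 1) / 2 * (1 - s)\<^sup>2 - a * s * (1 + (a + 1) * (1 - s)))\<bar>"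
    using c by (simp add: abs_mult)
  also have "\<dots> = \<bar>kern a \<rho> u + u * kern' a \<rho> u\<bar>"
    by (simp only: k(1,2) algebra_simps)
  finally show "\<bar>kern a \<rho> u + u * kern' a \<rho> u\<bar> \<le> (1 + 2 * a)\<^sup>2 * \<rho> powr (- a)"
    by (simp add: p mult_ac)
  have "\<bar>a * (a + 1) * s\<^sup>2 - 2 * (a * s * (1 + (a + 1) * (1 - s)))\<bar> \<le> 4 * (1 + 2 * a)\<^sup>2"
  proof -
    have "a * (a + 1) * 1 \<le> 4 * (1 + 2 * a)\<^sup>2" "2 * (a * 1 * (1 + (a + 1) * 1)) \<le> 4 * (1 + 2 * a)\<^sup>2"
      using a by (auto simp: power2_eq_square algebra_simps)
    then show ?thesis using b3 b4 b5 by linarith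
  qed
  then have "c * \<rho>\<^sup>2 * \<bar>a * (a + 1) * s\<^sup>2 - 2 * (a * s * (1 + (a + 1) * (1 - s)))\<bar>
      \<le> c * \<rho>\<^sup>2 * (4 * (1 + 2 * a)\<^sup>2)"
    using c by (intro mult_left_mono) auto
  also have "c * \<rho>\<^sup>2 * \<bar>a * (a + 1) * s\<^sup>2 - 2 * (a * s * (1 + (a + 1) * (1 - s)))\<bar>
      = \<bar>c * \<rho>\<^sup>2 * (a * (a + 1) * s\<^sup>2 - 2 * (a * s * (1 + (a + 1) * (1 - s))))\<bar>"
    using c by (simp add: abs_mult)
  also have "\<dots> = \<bar>u * (2 * kern' a \<rho> u + u * kern'' a \<rho> u)\<bar>"
    by (rule arg_cong[of _ _ abs]) (use k(2,3) in \<open>simp add: algebra_simps\<close>)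
  also have "\<dots> = u * \<bar>2 * kern' a \<rho> u + u * kern'' a \<rho> u\<bar>"
    using assms by (simp add: abs_mult)
  finally show "u * \<bar>2 * kern' a \<rho> u + u * kern'' a \<rho> u\<bar> \<le> 4 * (1 + 2 * a)\<^sup>2 * \<rho> powr (- a)"
    by (simp add: p mult_ac)
qed

end

text \<open>Above \<rho> equality holds. Below, with \<open>w = 1 - u / \<rho>\<close>, the kernel
  is a multiple of the binomial series of (1 - w)^(-1/2) cut after the quadratic term, and the
  omitted terms are nonnegative; squaring turns this into a polynomial inequality. It makes the
  correction for \<open>k = 1\<close> positive.\<close>

lemma kern_half_le:
  assumes "0 < \<rho>" "0 \<le> u"
  shows "sqrt u * kern (1/2) \<rho> u \<le> 1"
proof (cases "u \<le> \<rho>")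
  case True
  obtain s where s: "u = s * \<rho>" "0 \<le> s" "s \<le> 1"
    using assms True by (metis divide_le_eq_1_pos divide_nonneg_pos nonzero_divide_eq_eq less_numeral_extra(3))
  define w where "w = 1 - s"
  have w: "0 \<le> w" "w \<le> 1" using s by (auto simp: w_def)
  have p: "\<rho> powr (- (1/2) - 2) = 1 / (sqrt \<rho> * \<rho>\<^sup>2)"
    using assms powr_add[of \<rho> "-(1/2)" "-2"] by (simp add: powr_minus powr_half_sqrt field_simps)
  have "sqrt u * kern (1/2) \<rho> u = sqrt s * (1 + w / 2 + 3 / 8 * w\<^sup>2)"
    using assms True unfolding kern_def Let_def p max_absorb2[OF True]
    by (simp add: s(1) real_sqrt_mult w_def field_simps power2_eq_square)
  also have "\<dots> \<le> 1"
  proof (rule power2_le_imp_le)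
    have "(sqrt s * (1 + w / 2 + 3 / 8 * w\<^sup>2))\<^sup>2 = (1 - w) * (1 + w / 2 + 3 / 8 * w\<^sup>2)\<^sup>2"
      using s by (simp add: power_mult_distrib w_def)
    also have "\<dots> = 1 - (5/8 * w^3 + 15/64 * w^4 + 9/64 * w^5)"
      by (simp add: field_simps power2_eq_square power3_eq_cube power4_eq_xxxx eval_nat_numeral)
    also have "\<dots> \<le> 1"
    proof -
      have "0 \<le> 5/8 * w^3 + 15/64 * w^4 + 9/64 * w^5" using w by (intro add_nonneg_nonneg) auto
      then show ?thesis by linarith
    qed
    finally show "(sqrt s * (1 + w / 2 + 3 / 8 * w\<^sup>2))\<^sup>2 \<le> 1\<^sup>2" by simp
  qed simp
  finally show ?thesis .
next
  case False
  then have "u powr (- (1/2) - 2) = 1 / (sqrt u * u\<^sup>2)"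
    using assms powr_add[of u "-(1/2)" "-2"] by (simp add: powr_minus powr_half_sqrt field_simps)
  then show ?thesis
    using False assms by (simp add: kern_def max_def field_simps)
qed

lemma ex_antiderivative_poly:
  fixes p :: "real poly"
  obtains q where "pderiv q = p" "poly q 1 = c"
proof -
  define r where "r = (\<Sum>i\<le>degree p. monom (coeff p i / real (Suc i)) (Suc i))"
  have "pderiv r = (\<Sum>i\<le>degree p. monom (coeff p i) i)"
    unfolding r_def by (simp add: higher_pderiv_sum[of 1, simplified] pderiv_monom del: of_nat_Suc)
  then have "pderiv r = p" by (simp add: poly_as_sum_of_monoms)
  then have "pderiv (r + [:c - poly r 1:]) = p" by (simp add: pderiv_add pderiv_pCons)
  moreover have "poly (r + [:c - poly r 1:]) 1 = c" by simp
  ultimately show thesis using that by blast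
qed

lemma abs_le_of_derivative_le:
  fixes f :: "real \<Rightarrow> real"
  assumes "\<And>u. u \<in> {0..4} \<Longrightarrow> (f has_real_derivative f' u) (at u)"
    and "\<And>u. u \<in> {0..4} \<Longrightarrow> \<bar>f' u\<bar> \<le> B" "f 1 = 0" "u \<in> {0..4}"
  shows "\<bar>f u\<bar> \<le> 3 * B"
proof -
  have "norm (f u - f 1) \<le> B * norm (u - 1)"
    using assms by (intro field_differentiable_bound[of "{0..4}" f f'])
      (auto intro: has_field_derivative_at_within)
  moreover have "B * norm (u - 1) \<le> B * 3"
    using assms(2)[of 1] assms(4) by (intro mult_left_mono) auto
  ultimately show ?thesis using assms(3) by simp
qed

text \<open>A polynomial approximation of \<open>kern''\<close> is integrated twice with prescribed
  values at 1. The value of \<open>P\<close> at 1 must be exact, since it enters the boundary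
  identity; on {0..4}, which contains all arguments that arise from points of the ball, closeness
  suffices.\<close>

lemma kern_poly_approx:
  assumes "0 < a" "0 < \<rho>" "\<rho> < 1" "0 < \<eta>"
  obtains P where "poly P 1 = 1"
    "\<And>u. u \<in> {0..4} \<Longrightarrow> \<bar>poly P u - kern a \<rho> u\<bar> \<le> \<eta>"
    "\<And>u. u \<in> {0..4} \<Longrightarrow> \<bar>poly (pderiv P) u - kern' a \<rho> u\<bar> \<le> \<eta>"
    "\<And>u. u \<in> {0..4} \<Longrightarrow> \<bar>poly (pderiv (pderiv P)) u - kern'' a \<rho> u\<bar> \<le> \<eta>"
proof -
  \<comment> \<open>Points of {0..4} have distance at most 3 from 1, so each of the two integrations
    multiplies the error by at most 3.\<close>
  have "0 < \<eta> / 9" using assms by simp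
  then obtain g where g: "real_polynomial_function g" "\<And>u. u \<in> {0..4} \<Longrightarrow> \<bar>kern'' a \<rho> u - g u\<bar> < \<eta> / 9"
    using Stone_Weierstrass_real_polynomial_function[of "{0..4::real}" "kern'' a \<rho>" "\<eta> / 9"]
      continuous_kern''[OF assms(1,2)] by auto
  from g(1) obtain c n where "g = (\<lambda>x. \<Sum>i\<le>n. c i * x ^ i)"
    using real_polynomial_function_iff_sum by auto
  then have gp: "g = poly (\<Sum>i\<le>n. monom (c i) i)"
    by (auto simp: fun_eq_iff poly_sum poly_monom)
  obtain p where p: "pderiv p = (\<Sum>i\<le>n. monom (c i) i)" "poly p 1 = kern' a \<rho> 1"
    using ex_antiderivative_poly by blast
  obtain P where P: "pderiv P = p" "poly P 1 = kern a \<rho> 1"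
    using ex_antiderivative_poly by blast
  have 2: "\<bar>poly (pderiv (pderiv P)) u - kern'' a \<rho> u\<bar> \<le> \<eta> / 9" if "u \<in> {0..4}" for u
    using g(2)[OF that] by (simp add: p P gp[symmetric] abs_minus_commute)
  have 1: "\<bar>poly (pderiv P) u - kern' a \<rho> u\<bar> \<le> 3 * (\<eta> / 9)" if "u \<in> {0..4}" for u
    by (rule abs_le_of_derivative_le[where f = "\<lambda>u. poly (pderiv P) u - kern' a \<rho> u"])
       (use 2 p P that assms in \<open>auto intro!: derivative_eq_intros poly_DERIV DERIV_kern' simp: 2\<close>)
  have 0: "\<bar>poly P u - kern a \<rho> u\<bar> \<le> 3 * (3 * (\<eta> / 9))" if "u \<in> {0..4}" for u
    by (rule abs_le_of_derivative_le[where f = "\<lambda>u. poly P u - kern a \<rho> u"])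
       (use 1 p P that assms in \<open>auto intro!: derivative_eq_intros poly_DERIV DERIV_kern simp: 1\<close>)
  show thesis
    by (rule that[of P]) (use 0 1 2 assms P kern_at_1[of a \<rho>] in force)+
qed

section \<open>Divergence along planes\<close>

lemma
  assumes "S \<in> grassmannian k"
  shows finite_orthonormal_basis: "finite (orthonormal_basis S)"
    and card_orthonormal_basis: "card (orthonormal_basis S) = k"
    and inner_orthonormal_basis: "\<And>e. e \<in> orthonormal_basis S \<Longrightarrow> e \<bullet> e = 1"
proof -
  have S: "subspace S" "dim S = k" using assms by (auto simp: grassmannian_def)
  show "finite (orthonormal_basis S)"
    using orthonormal_basis(4)[OF S(1)] finiteI_independent by blast
  show "card (orthonormal_basis S) = k"
    using orthonormal_basis(5)[OF S(1)] S by simp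
  show "\<And>e. e \<in> orthonormal_basis S \<Longrightarrow> e \<bullet> e = 1"
    using orthonormal_basis(3)[OF S(1)] by (auto simp: norm_eq_sqrt_inner)
qed

lemma inner_plane_projection:
  "v \<bullet> plane_projection S w = (\<Sum>e\<in>orthonormal_basis S. (v \<bullet> e) * (w \<bullet> e))"
  by (simp add: plane_projection_apply inner_sum_right mult_ac)

lemma
  assumes S: "S \<in> grassmannian k"
  shows plane_projection_mem: "plane_projection S v \<in> S"
    and norm_diff_plane_projection:
      "(norm (v - plane_projection S v))\<^sup>2 = v \<bullet> v - v \<bullet> plane_projection S v"
    and inner_plane_projection_nonneg: "0 \<le> v \<bullet> plane_projection S v"
    and inner_plane_projection_le: "v \<bullet> plane_projection S v \<le> v \<bullet> v"
proof -
  have sub: "subspace S" using S by (auto simp: grassmannian_def)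
  let ?B = "orthonormal_basis S"
  show "plane_projection S v \<in> S"
    unfolding plane_projection_apply
    using orthonormal_basis(1)[OF sub] sub by (intro subspace_sum subspace_scale) auto
  have "plane_projection S v \<bullet> e = v \<bullet> e" if "e \<in> ?B" for e
  proof -
    have "plane_projection S v \<bullet> e = (\<Sum>b\<in>?B. if b = e then v \<bullet> e else 0)"
      unfolding plane_projection_apply inner_sum_left
      using orthonormal_basis(2)[OF sub] that inner_orthonormal_basis[OF S]
      by (intro sum.cong) (auto simp: pairwise_def orthogonal_def)
    then show ?thesis using that finite_orthonormal_basis[OF S] by simp
  qed
  then have PP: "plane_projection S v \<bullet> plane_projection S v = v \<bullet> plane_projection S v"
    unfolding inner_plane_projection by simp
  then show eq: "(norm (v - plane_projection S v))\<^sup>2 = v \<bullet> v - v \<bullet> plane_projection S v"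
    unfolding power2_norm_eq_inner by (simp add: inner_diff inner_commute)
  show "0 \<le> v \<bullet> plane_projection S v"
    unfolding inner_plane_projection by (intro sum_nonneg) auto
  show "v \<bullet> plane_projection S v \<le> v \<bullet> v"
    using eq zero_le_power2[of "norm (v - plane_projection S v)"] by linarith
qed

lemma plane_divergence_eq:
  assumes "(X has_derivative D) (at x)"
  shows "plane_divergence S X x = (\<Sum>e\<in>orthonormal_basis S. D e \<bullet> e)"
  unfolding plane_divergence_def frechet_derivative_eqI[OF assms] ..

lemma plane_divergence_diff:
  assumes "smooth X" "smooth Y"
  shows "plane_divergence S (\<lambda>x. X x - Y x) x = plane_divergence S X x - plane_divergence S Y x"
  using plane_divergence_eq[OF has_derivative_diff[OF assms[THEN smooth_has_derivative]], of S x]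
  by (simp add: plane_divergence_def inner_diff_left sum_subtractf)

lemma plane_divergence_scaled_ident:
  assumes "S \<in> grassmannian k"
  shows "plane_divergence S (\<lambda>x. c *\<^sub>R x) x = c * real k"
proof -
  have "((\<lambda>x. c *\<^sub>R x) has_derivative (\<lambda>h. c *\<^sub>R h)) (at x)"
    by (auto intro!: derivative_eq_intros)
  from plane_divergence_eq[OF this, of S] show ?thesis
    using inner_orthonormal_basis[OF assms] card_orthonormal_basis[OF assms] by simp
qed

lemma has_derivative_poly_scaleR:
  assumes "(q has_derivative (\<lambda>h. \<beta> * (z x \<bullet> h))) (at x)" "(z has_derivative (\<lambda>h. a *\<^sub>R h)) (at x)"
  shows "((\<lambda>x. poly P (q x) *\<^sub>R z x) has_derivative
    (\<lambda>h. (poly P (q x) * a) *\<^sub>R h + (poly (pderiv P) (q x) * \<beta> * (z x \<bullet> h)) *\<^sub>R z x)) (at x)"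
proof -
  have "((\<lambda>x. poly P (q x)) has_derivative (\<lambda>h. (\<beta> * (z x \<bullet> h)) * poly (pderiv P) (q x))) (at x)"
    using has_derivative_compose[OF assms(1) poly_DERIV[unfolded has_field_derivative_def]]
    by (simp add: mult_ac)
  from has_derivative_scaleR[OF this assms(2)] show ?thesis
    by (simp add: mult_ac)
qed

text \<open>The pole field, the image field and the radial family all have this shape. Since the
  gradient of \<open>q\<close> is a multiple of \<open>z\<close>, differentiating the coefficient
  contributes only the squared length of the projection of \<open>z\<close> onto
  \<open>S\<close>.\<close>

lemma plane_divergence_poly_scaleR:
  assumes "S \<in> grassmannian k"
    and "(q has_derivative (\<lambda>h. \<beta> * (z x \<bullet> h))) (at x)" "(z has_derivative (\<lambda>h. a *\<^sub>R h)) (at x)"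
  shows "plane_divergence S (\<lambda>x. poly P (q x) *\<^sub>R z x) x
    = real k * a * poly P (q x) + \<beta> * poly (pderiv P) (q x) * (z x \<bullet> plane_projection S (z x))"
proof -
  have "plane_divergence S (\<lambda>x. poly P (q x) *\<^sub>R z x) x
      = (\<Sum>e\<in>orthonormal_basis S. poly P (q x) * a + \<beta> * poly (pderiv P) (q x) * ((z x \<bullet> e) * (z x \<bullet> e)))"
    unfolding plane_divergence_eq[OF has_derivative_poly_scaleR[OF assms(2,3)]]
    using inner_orthonormal_basis[OF assms(1)]
    by (intro sum.cong) (auto simp: inner_add_left algebra_simps)
  then show ?thesis
    using card_orthonormal_basis[OF assms(1)]
    by (simp add: sum.distrib inner_plane_projection sum_distrib_left)
qed

text \<open>
  The square of \<open>|y| |x - y / |y|\<^sup>2|\<close>, in a form that is also meaningful for \<open>y = 0\<close>.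
\<close>

definition kelvin_sq :: "'a::euclidean_space \<Rightarrow> 'a \<Rightarrow> real" where
  "kelvin_sq y x = (y \<bullet> y) * (x \<bullet> x) - 2 * (x \<bullet> y) + 1"

lemma kelvin_sq_bounds:
  assumes "norm x \<le> 1" "norm y \<le> 1"
  shows "0 \<le> kelvin_sq y x" "kelvin_sq y x \<le> 4"
proof -
  define c where "c = norm x * norm y"
  have c: "\<bar>x \<bullet> y\<bar> \<le> c" unfolding c_def by (rule Cauchy_Schwarz_ineq2)
  have eq: "kelvin_sq y x = (1 - c)\<^sup>2 + 2 * (c - x \<bullet> y)" "kelvin_sq y x = (1 + c)\<^sup>2 - 2 * (c + x \<bullet> y)"
    by (simp_all add: c_def kelvin_sq_def power2_eq_square algebra_simps flip: power2_norm_eq_inner)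
  show "0 \<le> kelvin_sq y x" unfolding eq(1) using c by simp
  have "0 \<le> c" "c \<le> 1" using assms by (auto simp: c_def intro: mult_le_one)
  then have "(1 + c)\<^sup>2 \<le> 4" using power_mono[of "1 + c" 2 2] by simp
  moreover have "0 \<le> c + x \<bullet> y" using c by simp
  ultimately show "kelvin_sq y x \<le> 4" unfolding eq(2) by simp
qed

lemma kelvin_sq_ge:
  assumes "norm x \<le> 1" "norm y \<le> 1"
  shows "(x - y) \<bullet> (x - y) \<le> kelvin_sq y x"
proof -
  have "kelvin_sq y x - (x - y) \<bullet> (x - y) = (1 - (norm x)\<^sup>2) * (1 - (norm y)\<^sup>2)"
    by (simp add: kelvin_sq_def algebra_simps inner_diff inner_commute power2_norm_eq_inner)
  also have "\<dots> \<ge> 0" using assms by (simp add: power_le_one)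
  finally show ?thesis by simp
qed

text \<open>Consequently the truncation at \<rho> is felt along the segment from 0 to
  \<open>x\<close> only for \<open>t\<close> within the square root of \<rho> of 1.\<close>

lemma kelvin_sq_scale_ge:
  assumes "norm x \<le> 1" "norm y \<le> 1" "0 \<le> t" "t \<le> 1"
  shows "(1 - t)\<^sup>2 \<le> kelvin_sq y (t *\<^sub>R x)"
proof -
  have "\<bar>x \<bullet> y\<bar> \<le> norm x * norm y" by (rule Cauchy_Schwarz_ineq2)
  then have "t * (x \<bullet> y) \<le> t * (norm x * norm y)" using assms by (intro mult_left_mono) auto
  moreover have "kelvin_sq y (t *\<^sub>R x) = (1 - t * (norm x * norm y))\<^sup>2 + 2 * (t * (norm x * norm y) - t * (x \<bullet> y))"
    by (simp add: kelvin_sq_def power2_eq_square algebra_simps flip: power2_norm_eq_inner)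
  moreover have "(1 - t)\<^sup>2 \<le> (1 - t * (norm x * norm y))\<^sup>2"
    using assms mult_left_mono[of "norm x * norm y" 1 t] mult_le_one[of "norm x" "norm y"]
    by (intro power_mono) auto
  ultimately show ?thesis by auto
qed

text \<open>As projections do not increase length, this supplies the hypothesis
  \<open>T \<le> n * u\<close> of \<open>image_term\<close> and \<open>radial_term\<close>, with
  \<open>n = y \<bullet> y\<close>.\<close>

lemma inner_self_kelvin_sq:
  "((y \<bullet> y) *\<^sub>R x - y) \<bullet> ((y \<bullet> y) *\<^sub>R x - y) = (y \<bullet> y) * kelvin_sq y x"
  by (simp add: kelvin_sq_def inner_diff inner_commute algebra_simps)

lemma kelvin_sq_sphere:
  assumes "norm p = 1"
  shows "kelvin_sq y p = (p - y) \<bullet> (p - y)"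
proof -
  have "p \<bullet> p = 1" using assms by (simp add: norm_eq_1)
  then show ?thesis by (simp add: kelvin_sq_def inner_diff inner_commute)
qed

lemma kelvin_sq_has_derivative:
  "((\<lambda>x. kelvin_sq y (t *\<^sub>R x)) has_derivative (\<lambda>h. 2 * t * (((t * (y \<bullet> y)) *\<^sub>R x - y) \<bullet> h))) (at x)"
  unfolding kelvin_sq_def
  by (auto intro!: derivative_eq_intros simp: fun_eq_iff inner_diff inner_commute algebra_simps)

lemma smooth_kelvin_sq: "smooth (kelvin_sq y)"
  unfolding kelvin_sq_def by (intro smooth_intros)

section \<open>Pointwise bounds for polynomials close to the truncated power\<close>

locale kern_approx =
  fixes k :: nat and \<rho> \<eta> :: real and P :: "real poly"
  assumes k: "1 \<le> k" and \<rho>: "0 < \<rho>" "\<rho> < 1" and \<eta>: "0 < \<eta>" and P1: "poly P 1 = 1"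
    and P: "\<And>u. u \<in> {0..4} \<Longrightarrow> \<bar>poly P u - kern (k / 2) \<rho> u\<bar> \<le> \<eta>"
    and P': "\<And>u. u \<in> {0..4} \<Longrightarrow> \<bar>poly (pderiv P) u - kern' (k / 2) \<rho> u\<bar> \<le> \<eta>"
    and P'': "\<And>u. u \<in> {0..4} \<Longrightarrow> \<bar>poly (pderiv (pderiv P)) u - kern'' (k / 2) \<rho> u\<bar> \<le> \<eta>"
begin

text \<open>Twice the right-hand side of \<open>kern_flux\<close> at
  \<open>a = k / 2\<close>.\<close>

definition flux :: "real \<Rightarrow> real" where
  "flux u = real k * ((real k + 2) * (real k + 4) / 8) * (\<rho> powr (- real k / 2) * (max 0 (1 - u / \<rho>))\<^sup>2)"

text \<open>Twice the absolute value of the bound in \<open>kern'_le_4\<close> at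
  \<open>a = k / 2\<close>.\<close>

definition perp_const :: real where
  "perp_const = real k * 4 powr (- real k / 2 - 1)"

lemma k_half_pos: "0 < real k / 2" using k by simp

lemma kern_flux_k: "k * kern (k / 2) \<rho> u + 2 * u * kern' (k / 2) \<rho> u = flux u"
  using kern_flux[OF k_half_pos \<rho>(1), of u] by (simp add: flux_def field_simps)

text \<open>Here \<open>u\<close> is the squared length of a vector and \<open>T\<close> that of its
  projection. Writing \<open>T = u - (u - T)\<close> splits the exact expression into the flux and a
  multiple of \<open>u - T\<close>, which is positive as \<open>kern'\<close> is negative. The
  approximation costs \<open>k * \<eta>\<close> from \<open>P\<close> and \<open>8 * \<eta>\<close>
  from its derivative.\<close>

lemma pole_term:
  assumes "0 \<le> T" "T \<le> u" "u \<le> 4"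
  shows "flux u + perp_const * (u - T) - (real k + 8) * \<eta> \<le> real k * poly P u + 2 * poly (pderiv P) u * T"
proof -
  have u: "u \<in> {0..4}" using assms by simp
  have "k * (kern (k / 2) \<rho> u - \<eta>) \<le> real k * poly P u"
    using P[OF u] by (intro mult_left_mono) auto
  moreover have "(kern' (k / 2) \<rho> u - \<eta>) * T \<le> poly (pderiv P) u * T"
    using P'[OF u] assms by (intro mult_right_mono) auto
  moreover have "\<eta> * T \<le> \<eta> * 4" using \<eta> assms by (intro mult_left_mono) auto
  moreover have "kern' (k / 2) \<rho> u * (u - T) \<le> - (k / 2) * 4 powr (- (k / 2) - 1) * (u - T)"
    using kern'_le_4[OF k_half_pos \<rho>(1), of u] \<rho> assms by (intro mult_right_mono) auto
  ultimately show ?thesis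
    using kern_flux_k[of u] by (simp add: perp_const_def algebra_simps diff_divide_distrib)
qed

text \<open>Since \<open>kern'\<close> is nonpositive, replacing \<open>T\<close> by its upper bound
  \<open>n * u\<close> only decreases the exact expression, and what remains is
  \<open>n * flux u\<close>.\<close>

lemma image_term:
  fixes n T u :: real
  assumes "0 \<le> T" "T \<le> n * u" "0 \<le> u" "u \<le> 4" "0 \<le> n" "n \<le> 1"
  shows "- (real k + 8) * \<eta> \<le> real k * n * poly P u + 2 * poly (pderiv P) u * T"
proof -
  have u: "u \<in> {0..4}" using assms by simp
  have T4: "T \<le> 4" using assms mult_mono[of n 1 u 4] by simp
  have "(k * n) * (kern (k / 2) \<rho> u - \<eta>) \<le> (k * n) * poly P u"
    using P[OF u] assms by (intro mult_left_mono) auto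
  moreover have "(kern' (k / 2) \<rho> u - \<eta>) * T \<le> poly (pderiv P) u * T"
    using P'[OF u] assms by (intro mult_right_mono) auto
  moreover have "\<eta> * T \<le> \<eta> * 4" "k * \<eta> * n \<le> k * \<eta> * 1"
    using \<eta> T4 assms by (intro mult_left_mono; simp)+
  moreover have "kern' (k / 2) \<rho> u * (n * u) \<le> kern' (k / 2) \<rho> u * T"
    using kern'_nonpos[OF k_half_pos \<rho>(1)] assms by (intro mult_left_mono_neg) auto
  moreover have "0 \<le> n * flux u" using assms by (simp add: flux_def)
  ultimately show ?thesis
    by (simp add: kern_flux_k[symmetric] algebra_simps)
qed

text \<open>\<open>pCons 0 P\<close> is the function \<open>u * poly P u\<close>, the normal
  component on the sphere that has to be compensated.\<close>

definition Phi' :: "real poly" where "Phi' = pderiv (pCons 0 P)"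

lemma
  assumes "u \<in> {0..4}"
  shows Phi'_approx: "\<bar>poly Phi' u - (kern (k / 2) \<rho> u + u * kern' (k / 2) \<rho> u)\<bar> \<le> 5 * \<eta>"
    and pderiv_Phi'_approx:
      "\<bar>poly (pderiv Phi') u - (2 * kern' (k / 2) \<rho> u + u * kern'' (k / 2) \<rho> u)\<bar> \<le> 6 * \<eta>"
proof -
  have A: "\<bar>u * x - u * y\<bar> \<le> 4 * \<eta>" if "\<bar>x - y\<bar> \<le> \<eta>" for x y
    using mult_mono[of u 4 "\<bar>x - y\<bar>" \<eta>] assms that \<eta>
    by (simp add: abs_mult flip: right_diff_distrib)
  show "\<bar>poly Phi' u - (kern (k / 2) \<rho> u + u * kern' (k / 2) \<rho> u)\<bar> \<le> 5 * \<eta>"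
    using P[OF assms] A[OF P'[OF assms]] by (simp add: Phi'_def pderiv_pCons)
  show "\<bar>poly (pderiv Phi') u - (2 * kern' (k / 2) \<rho> u + u * kern'' (k / 2) \<rho> u)\<bar> \<le> 6 * \<eta>"
    using P'[OF assms] A[OF P''[OF assms]] by (simp add: Phi'_def pderiv_pCons pderiv_add)
qed

text \<open>Above \<rho> the two exact terms cancel when \<open>T = n * u\<close>, and a smaller
  \<open>T\<close> only helps. Below \<rho> the crude bounds of \<open>kern_inner\<close> are used;
  there \<open>1 + 2 * a\<close> becomes \<open>1 + k\<close>.\<close>

lemma radial_term:
  fixes n T u :: real
  assumes "0 \<le> T" "T \<le> n * u" "0 \<le> u" "u \<le> 4" "0 \<le> n" "n \<le> 1" and k2: "2 \<le> k"
  shows "real k * n * poly Phi' u + 2 * poly (pderiv Phi') u * T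
    \<le> (5 * real k + 48) * \<eta> + (if u < \<rho> then (real k + 8) * (1 + real k)\<^sup>2 * \<rho> powr (- real k / 2) else 0)"
proof -
  have u: "u \<in> {0..4}" using assms by simp
  have nu: "n * u \<le> u" using assms by (simp add: mult_left_le_one_le)
  define a b where "a = kern (k / 2) \<rho> u + u * kern' (k / 2) \<rho> u"
    and "b = 2 * kern' (k / 2) \<rho> u + u * kern'' (k / 2) \<rho> u"
  have "(k * n) * poly Phi' u \<le> (k * n) * (a + 5 * \<eta>)"
    using Phi'_approx[OF u] assms by (intro mult_left_mono) (auto simp: a_def)
  moreover have "poly (pderiv Phi') u * T \<le> (b + 6 * \<eta>) * T"
    using pderiv_Phi'_approx[OF u] assms by (intro mult_right_mono) (auto simp: b_def)
  moreover have "\<eta> * T \<le> \<eta> * 4" "k * \<eta> * n \<le> k * \<eta> * 1"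
    using \<eta> nu assms by (intro mult_left_mono; simp)+
  ultimately have 1: "k * n * poly Phi' u + 2 * poly (pderiv Phi') u * T
      \<le> (k * n * a + 2 * b * T) + (5 * real k + 48) * \<eta>"
    by (simp add: algebra_simps)
  have "k * n * a + 2 * b * T \<le> (if u < \<rho> then (real k + 8) * (1 + real k)\<^sup>2 * \<rho> powr (- real k / 2) else 0)"
  proof (cases "u < \<rho>")
    case True
    have "k * n * a \<le> k * 1 * \<bar>a\<bar>"
    proof -
      have "n * a \<le> \<bar>a\<bar>"
        using assms mult_left_mono[OF abs_ge_self[of a], of n] mult_right_mono[of n 1 "\<bar>a\<bar>"] by simp
      then have "k * (n * a) \<le> k * \<bar>a\<bar>" by (intro mult_left_mono) auto
      then show ?thesis by (simp add: mult_ac)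
    qed
    moreover have "b * T \<le> \<bar>b\<bar> * u"
      using assms nu by (intro mult_mono) auto
    moreover have "k * \<bar>a\<bar> \<le> k * ((1 + real k)\<^sup>2 * \<rho> powr (- real k / 2))"
      using kern_inner(1)[OF k_half_pos \<rho>(1), of u] assms True by (intro mult_left_mono) (auto simp: a_def)
    moreover have "\<bar>b\<bar> * u \<le> 4 * (1 + real k)\<^sup>2 * \<rho> powr (- real k / 2)"
      using kern_inner(2)[OF k_half_pos \<rho>(1), of u] assms True by (auto simp: b_def mult_ac)
    ultimately show ?thesis using True by (simp add: algebra_simps)
  next
    case False
    then have ab: "a = (1 - real k / 2) * u powr (- (k / 2))" "b = k / 2 * (k / 2 - 1) * u powr (- (k / 2) - 1)"
      using kern_outer[OF k_half_pos \<rho>(1), of u] by (auto simp: a_def b_def)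
    have "u powr (- (k / 2)) = u powr (- (k / 2) - 1) * u"
      using False \<rho> powr_add[of u "- (k / 2) - 1" 1] by simp
    then have "k * n * a + 2 * b * (n * u) = 0"
      unfolding ab by (simp add: field_simps)
    \<comment> \<open>The sign of \<open>b\<close> is that of \<open>k - 2\<close>; this is where
      \<open>k = 1\<close> fails.\<close>
    moreover have "0 \<le> b" unfolding ab using k2 by simp
    then have "b * T \<le> b * (n * u)" using assms by (intro mult_left_mono) auto
    ultimately show ?thesis using False by simp
  qed
  with 1 show ?thesis by linarith
qed

end

section \<open>The vector fields attached to a pole in the closed unit ball\<close>

context kern_approx
begin

context
  fixes y :: "'a::euclidean_space"
  assumes y: "norm y \<le> 1"
begin

lemma inner_y: "0 \<le> y \<bullet> y" "y \<bullet> y \<le> 1"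
  using y by (auto simp: norm_le_square)

definition pole_field :: "'a \<Rightarrow> 'a" where
  "pole_field x = poly P ((x - y) \<bullet> (x - y)) *\<^sub>R (x - y)"

text \<open>The counterpart of the pole field at the mirror image y / |y|^2 of the pole, rescaled so
  that it remains defined at \<open>y = 0\<close>.\<close>

definition image_field :: "'a \<Rightarrow> 'a" where
  "image_field x = poly P (kelvin_sq y x) *\<^sub>R ((y \<bullet> y) *\<^sub>R x - y)"

text \<open>The inner product with \<open>x\<close> is the \<open>t\<close>-derivative of
  \<open>- u * poly P u\<close> at \<open>u = kelvin_sq y (t *\<^sub>R x)\<close>. For the exact
  power, \<open>- 2 * Phi'\<close> is (k - 2) u^(-k/2), the kernel of the integral in the
  overview.\<close>

definition radial_family :: "real \<Rightarrow> 'a \<Rightarrow> 'a" where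
  "radial_family t x = poly (- 2 * Phi') (kelvin_sq y (t *\<^sub>R x)) *\<^sub>R ((t * (y \<bullet> y)) *\<^sub>R x - y)"

text \<open>
  On the sphere the inner product of \<open>pole_field x + image_field x\<close> with \<open>x\<close> is \<open>Q * poly P Q\<close> with
  \<open>Q = kelvin_sq y x\<close>; the next field is designed to turn this into the constant \<open>1\<close>.
\<close>

definition radial_field :: "'a \<Rightarrow> 'a" where
  "radial_field x = integral {0..1} (\<lambda>t. radial_family t x)"

lemma smooth_pole_field: "smooth pole_field"
  unfolding pole_field_def by (intro smooth_intros)

lemma smooth_image_field: "smooth image_field"
  unfolding image_field_def by (intro smooth_intros smooth_kelvin_sq)

lemma poly_family_radial: "poly_family radial_family"
proof -
  have K: "kelvin_sq y (t *\<^sub>R x) = t ^ 2 *\<^sub>R ((y \<bullet> y) * (x \<bullet> x)) + (t ^ 1 *\<^sub>R (- 2 * (x \<bullet> y)) + t ^ 0 *\<^sub>R 1)" for t x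
    by (simp add: kelvin_sq_def power2_eq_square algebra_simps)
  have Z: "(t * (y \<bullet> y)) *\<^sub>R x - y = t ^ 1 *\<^sub>R ((y \<bullet> y) *\<^sub>R x) + t ^ 0 *\<^sub>R (- y)" for t and x :: 'a
    by simp
  show ?thesis
    unfolding radial_family_def K Z
    by (intro poly_family_scaleR poly_family_poly poly_family.intros smooth_intros)
qed

lemmas radial_integral = poly_family_integral[OF poly_family_radial, folded radial_field_def]

lemma smooth_radial_field: "smooth radial_field"
  using radial_integral by (simp add: radial_field_def[abs_def])

lemma divergence_pole_field:
  assumes S: "S \<in> grassmannian k" and x: "norm x \<le> 1"
  shows "flux ((norm (x - y))\<^sup>2) + perp_const * (norm ((x - y) - plane_projection S (x - y)))\<^sup>2 - (real k + 8) * \<eta>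
    \<le> plane_divergence S pole_field x"
proof -
  have "norm (x - y) \<le> 2" using norm_triangle_ineq4[of x y] x y by simp
  then have "(x - y) \<bullet> (x - y) \<le> 4"
    using power_mono[of "norm (x - y)" 2 2] by (simp add: power2_norm_eq_inner)
  moreover have "plane_divergence S pole_field x = real k * 1 * poly P ((x - y) \<bullet> (x - y))
      + 2 * poly (pderiv P) ((x - y) \<bullet> (x - y)) * ((x - y) \<bullet> plane_projection S (x - y))"
    unfolding pole_field_def[abs_def]
    by (rule plane_divergence_poly_scaleR[OF S])
       (auto intro!: derivative_eq_intros simp: inner_commute)
  ultimately show ?thesis
    using pole_term[OF inner_plane_projection_nonneg[OF S] inner_plane_projection_le[OF S]]
    unfolding norm_diff_plane_projection[OF S] by (simp add: power2_norm_eq_inner)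
qed

lemma divergence_image_field:
  assumes S: "S \<in> grassmannian k" and x: "norm x \<le> 1"
  shows "- (real k + 8) * \<eta> \<le> plane_divergence S image_field x"
proof -
  let ?z = "(y \<bullet> y) *\<^sub>R x - y"
  have "plane_divergence S image_field x = real k * (y \<bullet> y) * poly P (kelvin_sq y x)
      + 2 * poly (pderiv P) (kelvin_sq y x) * (?z \<bullet> plane_projection S ?z)"
    unfolding image_field_def[abs_def]
    by (rule plane_divergence_poly_scaleR[OF S])
       (use kelvin_sq_has_derivative[of y 1 x] in \<open>auto intro!: derivative_eq_intros\<close>)
  then show ?thesis
    using image_term[OF inner_plane_projection_nonneg[OF S]
        inner_plane_projection_le[OF S, of ?z, unfolded inner_self_kelvin_sq]
        kelvin_sq_bounds[OF x y] inner_y]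
    by simp
qed

lemma divergence_radial_family:
  assumes S: "S \<in> grassmannian k" and x: "norm x \<le> 1" and t: "0 \<le> t" "t \<le> 1" and k2: "2 \<le> k"
  shows "- (2 * ((5 * real k + 48) * \<eta> + (if kelvin_sq y (t *\<^sub>R x) < \<rho> then (real k + 8) * (1 + real k)\<^sup>2 * \<rho> powr (- real k / 2) else 0)))
    \<le> plane_divergence S (radial_family t) x" (is "- (2 * ?E) \<le> _")
proof -
  let ?z = "(t * (y \<bullet> y)) *\<^sub>R x - y" and ?u = "kelvin_sq y (t *\<^sub>R x)"
  have tx: "norm (t *\<^sub>R x) \<le> 1" using x t by (simp add: mult_le_one)
  have zz: "?z = (y \<bullet> y) *\<^sub>R (t *\<^sub>R x) - y" by (simp add: mult_ac)
  have "plane_divergence S (radial_family t) x = real k * (t * (y \<bullet> y)) * poly (- 2 * Phi') ?u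
      + 2 * t * poly (pderiv (- 2 * Phi')) ?u * (?z \<bullet> plane_projection S ?z)"
    unfolding radial_family_def[abs_def]
    by (rule plane_divergence_poly_scaleR[OF S kelvin_sq_has_derivative])
       (auto intro!: derivative_eq_intros)
  also have "\<dots> = - (2 * (t * (real k * (y \<bullet> y) * poly Phi' ?u + 2 * poly (pderiv Phi') ?u * (?z \<bullet> plane_projection S ?z))))"
    by (simp add: pderiv_mult pderiv_minus algebra_simps flip: numeral_poly)
  finally have 1: "plane_divergence S (radial_family t) x = \<dots>" .
  have "real k * (y \<bullet> y) * poly Phi' ?u + 2 * poly (pderiv Phi') ?u * (?z \<bullet> plane_projection S ?z) \<le> ?E"
    by (rule radial_term[OF inner_plane_projection_nonneg[OF S] _ kelvin_sq_bounds[OF tx y] inner_y k2])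
       (use inner_plane_projection_le[OF S, of ?z] in \<open>simp add: zz inner_self_kelvin_sq del: scaleR_scaleR\<close>)
  then have "t * (real k * (y \<bullet> y) * poly Phi' ?u + 2 * poly (pderiv Phi') ?u * (?z \<bullet> plane_projection S ?z)) \<le> t * ?E"
    using t by (intro mult_left_mono)
  also have "\<dots> \<le> 1 * ?E"
    using t \<eta> by (intro mult_right_mono) auto
  finally show ?thesis using 1 by simp
qed

text \<open>The large error of \<open>divergence_radial_family\<close> occurs only for
  \<open>t\<close> in a final interval of length \<open>sqrt \<rho>\<close>, and only if
  \<open>x\<close> is near \<open>y\<close>. Integration over \<open>t\<close> gains the factor
  \<open>sqrt \<rho>\<close>, which makes the error of lower order than the flux.\<close>

lemma divergence_radial_field:
  assumes S: "S \<in> grassmannian k" and x: "norm x \<le> 1" and k2: "2 \<le> k"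
  shows "- (2 * ((5 * real k + 48) * \<eta> + (if norm (x - y) < 2 * sqrt \<rho>
      then sqrt \<rho> * ((real k + 8) * (1 + real k)\<^sup>2 * \<rho> powr (- real k / 2)) else 0)))
    \<le> plane_divergence S radial_field x"
proof -
  define r where "r = sqrt \<rho>"
  have r: "0 < r" "r < 1" "\<rho> = r\<^sup>2" using \<rho> by (auto simp: r_def)
  define C where "C = (real k + 8) * (1 + real k)\<^sup>2 * \<rho> powr (- real k / 2)"
  have C: "0 \<le> C" by (simp add: C_def)
  define E where "E = (5 * real k + 48) * \<eta>"
  define f where "f t = plane_divergence S (radial_family t) x" for t
  have cont: "continuous_on {0..1} f"
    unfolding f_def plane_divergence_def using radial_integral by (auto intro!: continuous_intros)
  have "plane_divergence S radial_field x
      = (\<Sum>e\<in>orthonormal_basis S. integral {0..1} (\<lambda>t. frechet_derivative (radial_family t) (at x) e) \<bullet> e)"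
    by (rule plane_divergence_eq) (use radial_integral in \<open>simp add: radial_field_def[abs_def]\<close>)
  also have "\<dots> = (\<Sum>e\<in>orthonormal_basis S. integral {0..1} (\<lambda>t. frechet_derivative (radial_family t) (at x) e \<bullet> e))"
    using radial_integral
    by (intro sum.cong integral_component_eq[symmetric] refl)
       (simp add: integral_inner_left integrable_continuous_interval)
  also have "\<dots> = integral {0..1} f"
    unfolding f_def plane_divergence_def
    using radial_integral
    by (intro Henstock_Kurzweil_Integration.integral_sum[symmetric] integrable_continuous_interval)
       (auto intro!: continuous_intros simp: finite_orthonormal_basis[OF S])
  finally have div: "plane_divergence S radial_field x = integral {0..1} f" .
  \<comment> \<open>The point \<open>t *\<^sub>R x\<close> is within \<open>r\<close> of
    \<open>y\<close> by \<open>kelvin_sq_ge\<close>, and within \<open>1 - t\<close> of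
    \<open>x\<close>.\<close>
  have near: "1 - t < r \<and> norm (x - y) < 2 * r" if "0 \<le> t" "t \<le> 1" "kelvin_sq y (t *\<^sub>R x) < \<rho>" for t
  proof
    have "(1 - t)\<^sup>2 < r\<^sup>2" using kelvin_sq_scale_ge[OF x y that(1,2)] that(3) r by simp
    then show tr: "1 - t < r" using r by (simp add: power2_less_imp_less)
    have tx: "norm (t *\<^sub>R x) \<le> 1" using x that by (simp add: mult_le_one)
    have "(norm (t *\<^sub>R x - y))\<^sup>2 < r\<^sup>2"
      using kelvin_sq_ge[OF tx y] that(3) r by (simp add: power2_norm_eq_inner)
    then have "norm (t *\<^sub>R x - y) < r" using r by (simp add: power2_less_imp_less)
    moreover have "norm (x - t *\<^sub>R x) \<le> 1 - t"
    proof -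
      have "norm (x - t *\<^sub>R x) = (1 - t) * norm x"
        using that norm_scaleR[of "1 - t" x] by (simp add: algebra_simps)
      also have "\<dots> \<le> 1 - t" using that x by (simp add: mult_left_le)
      finally show ?thesis .
    qed
    moreover have "norm (x - y) \<le> norm (x - t *\<^sub>R x) + norm (t *\<^sub>R x - y)"
      using norm_triangle_ineq[of "x - t *\<^sub>R x" "t *\<^sub>R x - y"] by simp
    ultimately show "norm (x - y) < 2 * r" using tr by simp
  qed
  have lower: "- (2 * (E + (if kelvin_sq y (t *\<^sub>R x) < \<rho> then C else 0))) \<le> f t" if "0 \<le> t" "t \<le> 1" for t
    unfolding f_def E_def C_def by (rule divergence_radial_family[OF S x that k2])
  have int: "f integrable_on {a..b}" if "0 \<le> a" "b \<le> 1" for a b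
    using cont that by (intro integrable_continuous_interval) (auto intro: continuous_on_subset)
  have "- (2 * (E + (if norm (x - y) < 2 * r then r * C else 0))) \<le> integral {0..1} f"
  proof (cases "norm (x - y) < 2 * r")
    case True
    have "(1 - r - 0) * (- (2 * E)) \<le> integral {0..1 - r} f"
    proof -
      have "- (2 * E) \<le> f t" if "t \<in> {0..1 - r}" for t
        using lower[of t] near[of t] that r by (auto split: if_splits)
      then have "integral {0..1 - r} (\<lambda>t. - (2 * E)) \<le> integral {0..1 - r} f"
        using r by (intro integral_le int) auto
      then show ?thesis using r by (simp add: algebra_simps)
    qed
    moreover have "(1 - (1 - r)) * (- (2 * (E + C))) \<le> integral {1 - r..1} f"
    proof -
      have "- (2 * (E + C)) \<le> f t" if "t \<in> {1 - r..1}" for t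
        using lower[of t] that r C by (auto split: if_splits)
      then have "integral {1 - r..1} (\<lambda>t. - (2 * (E + C))) \<le> integral {1 - r..1} f"
        using r by (intro integral_le int) auto
      then show ?thesis using r by simp
    qed
    moreover have "integral {0..1 - r} f + integral {1 - r..1} f = integral {0..1} f"
      using r int by (intro Henstock_Kurzweil_Integration.integral_combine) auto
    ultimately show ?thesis using True by (simp add: algebra_simps)
  next
    case False
    have "- (2 * E) \<le> f t" if "t \<in> {0..1}" for t
      using lower[of t] near[of t] that False by (auto split: if_splits)
    then have "integral {0..1} (\<lambda>t::real. - (2 * E)) \<le> integral {0..1} f"
      by (intro integral_le int) auto
    then show ?thesis using False by simp
  qed
  then show ?thesis unfolding div E_def C_def r_def .
qed

text \<open>The fundamental theorem of calculus in \<open>t\<close>: at \<open>t = 0\<close> the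
  argument \<open>kelvin_sq\<close> equals 1, where \<open>P1\<close> fixes the value, and at
  \<open>t = 1\<close> it is \<open>kelvin_sq y x\<close>.\<close>

lemma inner_radial_field: "radial_field x \<bullet> x = 1 - kelvin_sq y x * poly P (kelvin_sq y x)"
proof -
  define F where "F t = - poly (pCons 0 P) (kelvin_sq y (t *\<^sub>R x))" for t
  have D: "(F has_real_derivative radial_family t x \<bullet> x) (at t)" for t
  proof -
    have "((\<lambda>t. kelvin_sq y (t *\<^sub>R x)) has_real_derivative 2 * (((t * (y \<bullet> y)) *\<^sub>R x - y) \<bullet> x)) (at t)"
      unfolding kelvin_sq_def
      by (auto intro!: derivative_eq_intros simp: inner_diff inner_commute algebra_simps)
    from DERIV_minus[OF DERIV_chain2[OF poly_DERIV this, of "pCons 0 P"]] show ?thesis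
      unfolding F_def radial_family_def Phi'_def
      by (simp del: poly_pCons pderiv_pCons add: mult_ac flip: numeral_poly)
  qed
  have "((\<lambda>t. radial_family t x \<bullet> x) has_integral (F 1 - F 0)) {0..1}"
    by (intro fundamental_theorem_of_calculus)
       (auto intro: D has_field_derivative_at_within simp flip: has_real_derivative_iff_has_vector_derivative)
  moreover have "integral {0..1} (\<lambda>t. radial_family t x \<bullet> x) = radial_field x \<bullet> x"
    unfolding radial_field_def using radial_integral
    by (simp add: integral_component_eq integrable_continuous_interval)
  ultimately have "radial_field x \<bullet> x = F 1 - F 0" by (simp add: integral_unique)
  then show ?thesis by (simp add: F_def kelvin_sq_def P1)
qed

text \<open>On the sphere both kernels have the same argument Q, and the inner products of the two
  vectors with \<open>p\<close> add up to Q. Beyond algebra only \<open>P1\<close> enters, so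
  tangency is exact despite the approximation.\<close>

lemma inner_kelvin_fields:
  assumes "norm p = 1"
  shows "(p - pole_field p - image_field p - radial_field p) \<bullet> p = 0"
proof -
  have p: "p \<bullet> p = 1" using assms by (simp add: norm_eq_1)
  have "(p - pole_field p - image_field p - radial_field p) \<bullet> p
      = 1 - poly P (kelvin_sq y p) * ((p - y) \<bullet> p) - poly P (kelvin_sq y p) * (((y \<bullet> y) *\<^sub>R p - y) \<bullet> p)
        - (1 - kelvin_sq y p * poly P (kelvin_sq y p))"
    by (simp add: inner_diff_left inner_radial_field pole_field_def image_field_def p kelvin_sq_sphere[OF assms])
  also have "\<dots> = 0"
    by (simp add: kelvin_sq_def inner_diff_left p inner_commute algebra_simps)
  finally show ?thesis .
qed

end

end

section \<open>Test fields tangent to the sphere\<close>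

lemma (in kern_approx) ex_test_field_ge_2:
  fixes y :: "'a::euclidean_space"
  assumes y: "norm y \<le> 1" and k2: "2 \<le> k"
  shows "\<exists>X. smooth X \<and> (\<forall>p\<in>sphere 0 1. X p \<bullet> p = 0) \<and>
    (\<forall>x\<in>cball 0 1. \<forall>S\<in>grassmannian k. plane_divergence S X x \<le> real k + (12 * real k + 112) * \<eta>
      - flux ((norm (x - y))\<^sup>2) - perp_const * (norm ((x - y) - plane_projection S (x - y)))\<^sup>2
      + (if norm (x - y) < 2 * sqrt \<rho>
         then 2 * (real k + 8) * (1 + real k)\<^sup>2 * (sqrt \<rho> * \<rho> powr (- real k / 2)) else 0))"
proof (intro exI conjI ballI)
  let ?W = "\<lambda>x. 1 *\<^sub>R x - pole_field y x - image_field y x - radial_field y x"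
  show "smooth ?W"
    by (intro smooth_intros smooth_pole_field[OF y] smooth_image_field[OF y] smooth_radial_field[OF y])
  show "?W p \<bullet> p = 0" if "p \<in> sphere 0 1" for p
    using inner_kelvin_fields[OF y] that by simp
  fix x :: 'a and S :: "'a set" assume "x \<in> cball 0 1" and S: "S \<in> grassmannian k"
  then have x: "norm x \<le> 1" by simp
  have "plane_divergence S ?W x = 1 * real k - plane_divergence S (pole_field y) x
      - plane_divergence S (image_field y) x - plane_divergence S (radial_field y) x"
    by (subst plane_divergence_diff plane_divergence_scaled_ident[OF S] |
        intro smooth_intros smooth_pole_field[OF y] smooth_image_field[OF y] smooth_radial_field[OF y])+ simp
  \<comment> \<open>The error coefficient is \<open>k + 8\<close> from the pole,
    \<open>k + 8\<close> from its image and \<open>2 * (5 * k + 48)\<close> from the radial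
    field.\<close>
  then show "plane_divergence S ?W x \<le> real k + (12 * real k + 112) * \<eta>
      - flux ((norm (x - y))\<^sup>2) - perp_const * (norm ((x - y) - plane_projection S (x - y)))\<^sup>2
      + (if norm (x - y) < 2 * sqrt \<rho>
         then 2 * (real k + 8) * (1 + real k)\<^sup>2 * (sqrt \<rho> * \<rho> powr (- real k / 2)) else 0)"
    using divergence_pole_field[OF y S x] divergence_image_field[OF y S x] divergence_radial_field[OF y S x k2]
    by (auto simp: algebra_simps split: if_splits)
qed

text \<open>
  The correction field for \<open>k = 1\<close>: a large \<open>m\<close> makes the radial part of the derivative dominate the
  tangential gradient of \<open>H\<close>, and costs nothing on the sphere.
\<close>

lemma cutoff_divergence_nonneg:
  fixes y :: "'a::euclidean_space"
  assumes S: "S \<in> grassmannian 1" and x: "norm x \<le> 1" and y: "norm y \<le> 1"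
    and d: "0 < d" and H: "d / 2 \<le> poly H (x \<bullet> y)" and B: "\<bar>poly (pderiv H) (x \<bullet> y)\<bar> \<le> B"
    and m: "B\<^sup>2 / (2 * d\<^sup>2) \<le> real m" "0 < m"
  shows "0 \<le> plane_divergence S (\<lambda>x. ((x \<bullet> x) ^ m * poly H (x \<bullet> y)) *\<^sub>R x) x"
proof -
  obtain l where l: "m = Suc l" using m(2) gr0_implies_Suc by blast
  obtain e where e: "orthonormal_basis S = {e}"
    using card_orthonormal_basis[OF S] card_1_singletonE by metis
  have ee: "e \<bullet> e = 1" using inner_orthonormal_basis[OF S, of e] e by simp
  define s b c h h' where "s = x \<bullet> x" and "b = x \<bullet> e" and "c = y \<bullet> e" and "h = poly H (x \<bullet> y)"
    and "h' = poly (pderiv H) (x \<bullet> y)"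
  have hd: "((\<lambda>x. poly H (x \<bullet> y)) has_derivative (\<lambda>v. (v \<bullet> y) * h')) (at x)"
    unfolding h'_def
    using has_derivative_compose[OF has_derivative_inner_left[OF has_derivative_ident] poly_DERIV[unfolded has_field_derivative_def]]
    by (simp add: mult_ac)
  have "((\<lambda>x. ((x \<bullet> x) ^ m * poly H (x \<bullet> y)) *\<^sub>R x) has_derivative
     (\<lambda>v. (s ^ m * h) *\<^sub>R v + (s ^ m * ((v \<bullet> y) * h') + (2 * (real m * s ^ l * (x \<bullet> v))) * h) *\<^sub>R x)) (at x)"
    by (rule has_derivative_eq_rhs[OF has_derivative_scaleR[OF has_derivative_mult[OF
          has_derivative_power[OF has_derivative_inner[OF has_derivative_ident has_derivative_ident]] hd]
          has_derivative_ident]])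
       (simp add: l s_def h_def fun_eq_iff inner_commute algebra_simps)
  from plane_divergence_eq[OF this, of S]
  have "plane_divergence S (\<lambda>x. ((x \<bullet> x) ^ m * poly H (x \<bullet> y)) *\<^sub>R x) x
      = s ^ l * (s * h + s * c * h' * b + 2 * real m * h * b\<^sup>2)"
    by (simp add: e ee inner_add_left l b_def c_def inner_commute algebra_simps power2_eq_square)
  moreover have "0 \<le> s ^ l * (s * h + s * c * h' * b + 2 * real m * h * b\<^sup>2)"
  proof (rule mult_nonneg_nonneg)
    have s: "0 \<le> s" "s \<le> 1" using x by (auto simp: s_def norm_le_square)
    show "0 \<le> s ^ l" using s by simp
    have "\<bar>c\<bar> \<le> norm y * norm e" unfolding c_def by (rule Cauchy_Schwarz_ineq2)
    also have "norm e = 1" using ee by (simp add: norm_eq_1)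
    finally have c: "\<bar>c\<bar> \<le> 1" using y by simp
    have "\<bar>c * h'\<bar> \<le> 1 * B" unfolding abs_mult using c B by (intro mult_mono) (auto simp: h'_def)
    then have "\<bar>c * h'\<bar> * \<bar>b\<bar> \<le> B * \<bar>b\<bar>" by (intro mult_right_mono) auto
    then have "- (c * h' * b) \<le> B * \<bar>b\<bar>" by (simp add: abs_mult[symmetric])
    \<comment> \<open>Weighted arithmetic-geometric mean: the constant part is absorbed by the lower
      bound on \<open>H\<close>, the part quadratic in \<open>b\<close> by the term with factor
      \<open>m\<close>.\<close>
    also have "B * \<bar>b\<bar> \<le> d / 2 + B\<^sup>2 / (2 * d) * b\<^sup>2"
    proof -
      have "0 \<le> (d - B * \<bar>b\<bar>)\<^sup>2" by simp
      then have "2 * d * (B * \<bar>b\<bar>) \<le> d\<^sup>2 + B\<^sup>2 * b\<^sup>2" by (simp add: power2_diff power_mult_distrib)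
      then show ?thesis using d by (simp add: field_simps power2_eq_square)
    qed
    finally have 1: "s * (- (c * h' * b)) \<le> s * (d / 2 + B\<^sup>2 / (2 * d) * b\<^sup>2)"
      using s by (intro mult_left_mono)
    have 2: "s * (d / 2) \<le> s * h" using s H by (intro mult_left_mono) (auto simp: h_def)
    have "B\<^sup>2 / (2 * d) \<le> real m * d" using m(1) d by (simp add: field_simps power2_eq_square)
    also have "\<dots> \<le> 2 * real m * h"
      using H mult_left_mono[of "d" "2 * h" "real m"] by (simp add: h_def mult_ac)
    finally have "B\<^sup>2 / (2 * d) * b\<^sup>2 \<le> 2 * real m * h * b\<^sup>2" by (intro mult_right_mono) auto
    moreover have "s * (B\<^sup>2 / (2 * d) * b\<^sup>2) \<le> 1 * (B\<^sup>2 / (2 * d) * b\<^sup>2)"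
      using s d by (intro mult_right_mono) auto
    ultimately show "0 \<le> s * h + s * c * h' * b + 2 * real m * h * b\<^sup>2"
      using 1 2 by (simp add: algebra_simps)
  qed
  ultimately show ?thesis by simp
qed

text \<open>\<open>H\<close> is the normal component on the sphere of the first two terms of the
  field, written as a polynomial in \<open>x \<bullet> y\<close>; subtracting the cutoff field with
  coefficient \<open>H\<close> makes the result tangent. \<open>H\<close> is positive because
  \<open>1 - v\<close> is at most the square root of the kernel argument, so that
  \<open>kern_half_le\<close> applies.\<close>

lemma (in kern_approx) ex_test_field_1:
  fixes y :: "'a::euclidean_space"
  assumes y: "norm y \<le> 1" and k1: "k = 1"
  shows "\<exists>X. smooth X \<and> (\<forall>p\<in>sphere 0 1. X p \<bullet> p = 0) \<and>
    (\<forall>x\<in>cball 0 1. \<forall>S\<in>grassmannian k. plane_divergence S X x \<le> real k + 13 * \<eta>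
      - flux ((norm (x - y))\<^sup>2) - perp_const * (norm ((x - y) - plane_projection S (x - y)))\<^sup>2)"
proof -
  \<comment> \<open>The polynomial approximation can lower \<open>H\<close> by at most
    \<open>2 * \<eta>\<close>, so the slack \<open>d\<close> leaves \<open>H\<close> at least
    \<open>d / 2\<close>.\<close>
  define n d where "n = y \<bullet> y" and "d = 4 * \<eta>"
  have d: "0 < d" using \<eta> by (simp add: d_def)
  define H where "H = [:1 + d:] - [:1, - 1:] * pcompose P [:1 + n, - 2:]"
  have polyH: "poly H v = 1 + d - (1 - v) * poly P (1 + n - 2 * v)" for v
    by (simp add: H_def poly_pcompose algebra_simps)
  have "bounded (poly (pderiv H) ` {-1..1})"
    by (intro compact_imp_bounded compact_continuous_image continuous_intros compact_Icc)
  then obtain B where "\<forall>u\<in>poly (pderiv H) ` {-1..1}. norm u \<le> B"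
    unfolding bounded_iff by blast
  then have B: "\<bar>poly (pderiv H) v\<bar> \<le> B" if "v \<in> {-1..1}" for v
    using that by auto
  obtain m0 where "B\<^sup>2 / (2 * d\<^sup>2) \<le> real m0" using real_arch_simple by blast
  then obtain m where m: "B\<^sup>2 / (2 * d\<^sup>2) \<le> real m" "0 < m"
    by (intro that[of "Suc m0"]) auto
  have Hlow: "d / 2 \<le> poly H (x \<bullet> y)" if x: "norm x \<le> 1" for x
  proof -
    define v where "v = x \<bullet> y"
    have "\<bar>v\<bar> \<le> norm x * norm y" unfolding v_def by (rule Cauchy_Schwarz_ineq2)
    also have "\<dots> \<le> 1 * norm y" using x by (intro mult_right_mono) auto
    finally have v: "\<bar>v\<bar> \<le> norm y" by simp
    then have v1: "\<bar>v\<bar> \<le> 1" using y by simp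
    have n: "n = (norm y)\<^sup>2" "n \<le> 1" using y by (auto simp: n_def power2_norm_eq_inner norm_le_square)
    have "v\<^sup>2 \<le> n" using v by (simp add: n abs_le_square_iff[of v "norm y", simplified])
    then have q: "(1 - v)\<^sup>2 \<le> 1 + n - 2 * v" by (simp add: power2_diff)
    then have q0: "0 \<le> 1 + n - 2 * v" by (rule order_trans[OF zero_le_power2])
    have q4: "1 + n - 2 * v \<le> 4" using n v1 by simp
    have "1 - v \<le> sqrt (1 + n - 2 * v)" by (rule real_le_rsqrt[OF q])
    then have "(1 - v) * kern (1 / 2) \<rho> (1 + n - 2 * v) \<le> sqrt (1 + n - 2 * v) * kern (1 / 2) \<rho> (1 + n - 2 * v)"
      using kern_nonneg[of "1/2" \<rho>] \<rho> by (intro mult_right_mono) auto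
    also have "\<dots> \<le> 1" using kern_half_le[OF \<rho>(1) q0] .
    finally have "(1 - v) * kern (1 / 2) \<rho> (1 + n - 2 * v) \<le> 1" .
    moreover have "(1 - v) * poly P (1 + n - 2 * v) \<le> (1 - v) * (kern (1 / 2) \<rho> (1 + n - 2 * v) + \<eta>)"
      using P[of "1 + n - 2 * v"] q0 q4 v1 k1 by (intro mult_left_mono) auto
    moreover have "(1 - v) * \<eta> \<le> 2 * \<eta>" using v1 \<eta> by (intro mult_right_mono) auto
    ultimately show ?thesis by (simp add: polyH v_def[symmetric] d_def algebra_simps)
  qed
  let ?C = "\<lambda>x. ((x \<bullet> x) ^ m * poly H (x \<bullet> y)) *\<^sub>R x"
  let ?W = "\<lambda>x. (1 + d) *\<^sub>R x - pole_field y x - ?C x"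
  have sm: "smooth ?C" by (intro smooth_intros)
  show ?thesis
  proof (intro exI conjI ballI)
    show "smooth ?W"
      by (intro smooth_intros smooth_pole_field[OF y])
    show "?W p \<bullet> p = 0" if "p \<in> sphere 0 1" for p
    proof -
      have p: "p \<bullet> p = 1" using that by (simp add: norm_eq_1)
      have "(p - y) \<bullet> (p - y) = 1 + n - 2 * (p \<bullet> y)"
        by (simp add: n_def inner_diff p inner_commute)
      then show ?thesis
        by (simp add: pole_field_def[OF y] inner_diff_left p polyH inner_commute algebra_simps)
    qed
    fix x :: 'a and S :: "'a set" assume "x \<in> cball 0 1" and S: "S \<in> grassmannian k"
    then have x: "norm x \<le> 1" by simp
    have "x \<bullet> y \<in> {-1..1}"
      using Cauchy_Schwarz_ineq2[of x y] mult_le_one[OF x _ y] by auto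
    then have "0 \<le> plane_divergence S ?C x"
      using cutoff_divergence_nonneg[OF _ x y d Hlow[OF x] B m] S k1 by simp
    moreover have "plane_divergence S ?W x = (1 + d) * real k - plane_divergence S (pole_field y) x
        - plane_divergence S ?C x"
      by (subst plane_divergence_diff plane_divergence_scaled_ident[OF S] |
          intro smooth_intros smooth_pole_field[OF y])+ simp
    ultimately show "plane_divergence S ?W x \<le> real k + 13 * \<eta>
        - flux ((norm (x - y))\<^sup>2) - perp_const * (norm ((x - y) - plane_projection S (x - y)))\<^sup>2"
      using divergence_pole_field[OF y S x] by (simp add: k1 d_def algebra_simps)
  qed
qed

text \<open>With \<rho> equal to the square of \<open>r\<close>, the bound is expressed through
  \<open>(x - y) /\<^sub>R r\<close>, the rescaling used in \<open>approx_tangent_plane\<close>. The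
  parameter \<eta> is chosen to turn the total approximation error into \<epsilon>.\<close>

lemma ex_test_field:
  fixes y :: "'a::euclidean_space" and r \<epsilon> :: real
  assumes k: "1 \<le> k" and y: "norm y \<le> 1" and r: "0 < r" "r < 1" and \<epsilon>: "0 < \<epsilon>"
  obtains X where "smooth X" "\<And>p. p \<in> sphere 0 1 \<Longrightarrow> X p \<bullet> p = 0"
    "\<And>x S. x \<in> cball 0 1 \<Longrightarrow> S \<in> grassmannian k \<Longrightarrow>
      plane_divergence S X x \<le> real k + \<epsilon>
      - real k * ((real k + 2) * (real k + 4) / 8) * ((max 0 (1 - (norm ((x - y) /\<^sub>R r))\<^sup>2))\<^sup>2 / r ^ k)
      - real k * 4 powr (- real k / 2 - 1) * (norm ((x - y) - plane_projection S (x - y)))\<^sup>2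
      + (if norm ((x - y) /\<^sub>R r) < 2 then 2 * (real k + 8) * (1 + real k)\<^sup>2 * (r / r ^ k) else 0)"
proof -
  define \<eta> where "\<eta> = \<epsilon> / (12 * real k + 112)"
  have eta: "0 < \<eta>" "(12 * real k + 112) * \<eta> = \<epsilon>" using \<epsilon> by (auto simp: \<eta>_def add_pos_nonneg)
  have "0 < real k / 2" "0 < r\<^sup>2" "r\<^sup>2 < 1" using k r by (auto simp: power_less_one_iff)
  from kern_poly_approx[OF this eta(1)] obtain P where "kern_approx k (r\<^sup>2) \<eta> P"
    unfolding kern_approx_def using k r eta \<open>r\<^sup>2 < 1\<close> by (metis zero_less_power)
  then interpret kern_approx k "r\<^sup>2" \<eta> P .
  have rp: "r\<^sup>2 powr (- real k / 2) = 1 / r ^ k"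
  proof -
    have "r\<^sup>2 powr (- real k / 2) = (r powr 2) powr (- real k / 2)" using r by simp
    also have "\<dots> = r powr (- real k)" by (simp add: powr_powr)
    finally show ?thesis using r by (simp add: powr_minus powr_realpow field_simps)
  qed
  have nr: "(norm ((x - y) /\<^sub>R r))\<^sup>2 = (norm (x - y))\<^sup>2 / r\<^sup>2" "norm ((x - y) /\<^sub>R r) < 2 \<longleftrightarrow> norm (x - y) < 2 * sqrt (r\<^sup>2)" for x
  proof -
    have "norm ((x - y) /\<^sub>R r) = norm (x - y) / r" using r by (simp only: norm_scaleR) (simp add: divide_inverse mult.commute)
    then show "(norm ((x - y) /\<^sub>R r))\<^sup>2 = (norm (x - y))\<^sup>2 / r\<^sup>2"
      "norm ((x - y) /\<^sub>R r) < 2 \<longleftrightarrow> norm (x - y) < 2 * sqrt (r\<^sup>2)"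
      using r by (simp_all add: power_divide divide_less_eq)
  qed
  have "\<exists>X. smooth X \<and> (\<forall>p\<in>sphere 0 1. X p \<bullet> p = 0) \<and>
    (\<forall>x\<in>cball 0 1. \<forall>S\<in>grassmannian k. plane_divergence S X x \<le> real k + (12 * real k + 112) * \<eta>
      - flux ((norm (x - y))\<^sup>2) - perp_const * (norm ((x - y) - plane_projection S (x - y)))\<^sup>2
      + (if norm (x - y) < 2 * sqrt (r\<^sup>2)
         then 2 * (real k + 8) * (1 + real k)\<^sup>2 * (sqrt (r\<^sup>2) * (r\<^sup>2) powr (- real k / 2)) else 0))"
  proof (cases "k = 1")
    case True
    obtain X where X: "smooth X" "\<forall>p\<in>sphere 0 1. X p \<bullet> p = 0"
      "\<forall>x\<in>cball 0 1. \<forall>S\<in>grassmannian k. plane_divergence S X x \<le> real k + 13 * \<eta>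
        - flux ((norm (x - y))\<^sup>2) - perp_const * (norm ((x - y) - plane_projection S (x - y)))\<^sup>2"
      using ex_test_field_1[OF y True] by blast
    have "13 * \<eta> \<le> (12 * real k + 112) * \<eta>"
      using eta(1) by (intro mult_right_mono) auto
    then have "c + 13 * \<eta> - f - g \<le> c + (12 * real k + 112) * \<eta> - f - g + (if P then 2 * (real k + 8) * (1 + real k)\<^sup>2 * (sqrt (r\<^sup>2) * (r\<^sup>2) powr (- real k / 2)) else 0)" for c f g P
      by (auto simp: add_increasing2)
    then show ?thesis using X by (blast intro: order_trans)
  next
    case False
    then show ?thesis using ex_test_field_ge_2[OF y] k by simp
  qed
  then obtain X where X: "smooth X" "\<forall>p\<in>sphere 0 1. X p \<bullet> p = 0"
    "\<forall>x\<in>cball 0 1. \<forall>S\<in>grassmannian k. plane_divergence S X x \<le> real k + (12 * real k + 112) * \<eta>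
      - flux ((norm (x - y))\<^sup>2) - perp_const * (norm ((x - y) - plane_projection S (x - y)))\<^sup>2
      + (if norm (x - y) < 2 * sqrt (r\<^sup>2)
         then 2 * (real k + 8) * (1 + real k)\<^sup>2 * (sqrt (r\<^sup>2) * (r\<^sup>2) powr (- real k / 2)) else 0)"
    by blast
  show thesis
  proof (rule that[OF X(1)])
    show "X p \<bullet> p = 0" if "p \<in> sphere 0 1" for p using X(2) that by blast
    fix x :: 'a and S :: "'a set" assume "x \<in> cball 0 1" "S \<in> grassmannian k"
    then have "plane_divergence S X x \<le> real k + \<epsilon>
      - flux ((norm (x - y))\<^sup>2) - perp_const * (norm ((x - y) - plane_projection S (x - y)))\<^sup>2
      + (if norm (x - y) < 2 * sqrt (r\<^sup>2)
         then 2 * (real k + 8) * (1 + real k)\<^sup>2 * (sqrt (r\<^sup>2) * (r\<^sup>2) powr (- real k / 2)) else 0)"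
      using X(3) unfolding eta(2) by blast
    moreover have "flux ((norm (x - y))\<^sup>2) = real k * ((real k + 2) * (real k + 4) / 8)
        * ((max 0 (1 - (norm ((x - y) /\<^sub>R r))\<^sup>2))\<^sup>2 / r ^ k)"
      unfolding flux_def rp nr by simp
    moreover have "sqrt (r\<^sup>2) * r\<^sup>2 powr (- real k / 2) = r / r ^ k"
      unfolding rp using r by simp
    ultimately show "plane_divergence S X x \<le> real k + \<epsilon>
      - real k * ((real k + 2) * (real k + 4) / 8) * ((max 0 (1 - (norm ((x - y) /\<^sub>R r))\<^sup>2))\<^sup>2 / r ^ k)
      - real k * 4 powr (- real k / 2 - 1) * (norm ((x - y) - plane_projection S (x - y)))\<^sup>2
      + (if norm ((x - y) /\<^sub>R r) < 2 then 2 * (real k + 8) * (1 + real k)\<^sup>2 * (r / r ^ k) else 0)"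
      by (simp only: nr(2) perp_const_def)
  qed
qed

section \<open>An integral over a plane\<close>

lemma norm_sum_orthonormal_basis:
  assumes S: "S \<in> grassmannian k"
  shows "norm (\<Sum>b\<in>orthonormal_basis S. c b *\<^sub>R b) = sqrt (\<Sum>b\<in>orthonormal_basis S. (c b)\<^sup>2)"
proof -
  have sub: "subspace S" using S by (auto simp: grassmannian_def)
  have "(norm (\<Sum>b\<in>orthonormal_basis S. c b *\<^sub>R b))\<^sup>2 = (\<Sum>b\<in>orthonormal_basis S. (norm (c b *\<^sub>R b))\<^sup>2)"
    using orthonormal_basis(2)[OF sub]
    by (intro norm_sum_Pythagorean finite_orthonormal_basis[OF S])
       (auto simp: pairwise_def orthogonal_def)
  also have "\<dots> = (\<Sum>b\<in>orthonormal_basis S. (c b)\<^sup>2)"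
    using orthonormal_basis(3)[OF sub] by (intro sum.cong) auto
  finally show ?thesis by (simp add: real_sqrt_unique)
qed

text \<open>The integrand is minus the derivative of (1 - s^2)^2. This layer-cake form writes the
  bump as a superposition of indicators of balls.\<close>

lemma nn_integral_bump:
  fixes q :: real
  assumes "0 \<le> q"
  shows "(\<integral>\<^sup>+s. ennreal (4 * s * (1 - s\<^sup>2)) * indicator {0..1} s * indicator {q..} s \<partial>lborel)
    = ennreal ((max 0 (1 - q\<^sup>2))\<^sup>2)"
proof (cases "q \<le> 1")
  case True
  have "(\<integral>\<^sup>+s. ennreal (4 * s * (1 - s\<^sup>2)) * indicator {0..1} s * indicator {q..} s \<partial>lborel)
      = (\<integral>\<^sup>+s. ennreal (4 * s * (1 - s\<^sup>2)) * indicator {q..1} s \<partial>lborel)"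
    using assms by (intro nn_integral_cong) (auto simp: indicator_def)
  also have "\<dots> = ennreal ((- (1 - 1\<^sup>2)\<^sup>2) - (- (1 - q\<^sup>2)\<^sup>2))"
    using assms True
    by (intro nn_integral_FTC_Icc) (auto intro!: derivative_eq_intros simp: power_le_one has_real_derivative_iff_has_vector_derivative[symmetric])
  finally show ?thesis using assms True by (simp add: power_le_one)
next
  case False
  then have "1 \<le> q\<^sup>2" by (simp add: one_le_power)
  moreover have "(\<integral>\<^sup>+s. ennreal (4 * s * (1 - s\<^sup>2)) * indicator {0..1} s * indicator {q..} s \<partial>lborel)
      = (\<integral>\<^sup>+s. 0 \<partial>(lborel :: real measure))"
    using False by (intro nn_integral_cong) (auto simp: indicator_def)
  ultimately show ?thesis by simp
qed

text \<open>By Fubini and the volume of balls, the integral becomes that of 4 s (1 - s^2) times the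
  volume of the \<open>k\<close>-ball of radius s. The value cancels the factor (k + 2) (k + 4) / 8
  in the flux.\<close>

lemma integral_bump_plane:
  assumes S: "S \<in> grassmannian k" and k: "1 \<le> k"
  shows "(\<integral>z. (max 0 (1 - (norm z)\<^sup>2))\<^sup>2 \<partial>plane_lborel S)
    = unit_ball_vol (real k) * (8 / ((real k + 2) * (real k + 4)))"
proof -
  let ?B = "orthonormal_basis S" and ?w = "unit_ball_vol (real k)"
  let ?N = "\<Pi>\<^sub>M b\<in>?B. (lborel :: real measure)"
  let ?\<Phi> = "\<lambda>c. \<Sum>b\<in>?B. c b *\<^sub>R b"
  define F where "F s = 4 * ?w * (s ^ (k + 2) / real (k + 2) - s ^ (k + 4) / real (k + 4))" for s
  define q where "q c = norm (?\<Phi> c)" for c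
  interpret product_sigma_finite "\<lambda>_. lborel :: real measure" ..
  interpret N: sigma_finite_measure ?N
    using finite_orthonormal_basis[OF S] by (rule sigma_finite)
  interpret pair_sigma_finite "lborel :: real measure" ?N ..
  have meas: "?\<Phi> \<in> ?N \<rightarrow>\<^sub>M borel" by measurable
  have q[measurable]: "q \<in> borel_measurable ?N" unfolding q_def by measurable
  have ball: "emeasure ?N {c\<in>space ?N. q c \<le> s} = ennreal (?w * s ^ k)" if "0 < s" for s
  proof -
    have "{c\<in>space ?N. q c \<le> s} = {f. sqrt (\<Sum>i\<in>?B. (f i)\<^sup>2) \<le> s} \<inter> space ?N"
      by (auto simp: q_def norm_sum_orthonormal_basis[OF S])
    then show ?thesis
      using emeasure_cball_aux[OF finite_orthonormal_basis[OF S] that] card_orthonormal_basis[OF S] by simp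
  qed
  have "(\<integral>\<^sup>+c. ennreal ((max 0 (1 - (q c)\<^sup>2))\<^sup>2) \<partial>?N)
      = (\<integral>\<^sup>+c. (\<integral>\<^sup>+s. ennreal (4 * s * (1 - s\<^sup>2)) * indicator {0..1} s * indicator {q c..} s \<partial>lborel) \<partial>?N)"
    by (subst nn_integral_bump) (auto simp: q_def)
  also have "\<dots> = (\<integral>\<^sup>+c. (\<integral>\<^sup>+s. ennreal (4 * s * (1 - s\<^sup>2)) * indicator {0..1} s * indicator {p. q (snd p) \<le> fst p} (s, c) \<partial>lborel) \<partial>?N)"
    by (intro nn_integral_cong) (auto simp: indicator_def)
  also have "\<dots> = (\<integral>\<^sup>+s. (\<integral>\<^sup>+c. ennreal (4 * s * (1 - s\<^sup>2)) * indicator {0..1} s * indicator {p. q (snd p) \<le> fst p} (s, c) \<partial>?N) \<partial>lborel)"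
    by (rule Fubini') measurable
  also have "\<dots> = (\<integral>\<^sup>+s. ennreal (4 * s * (1 - s\<^sup>2)) * indicator {0..1} s * (\<integral>\<^sup>+c. indicator {c\<in>space ?N. q c \<le> s} c \<partial>?N) \<partial>lborel)"
    by (subst nn_integral_cmult[symmetric], measurable)
       (intro nn_integral_cong, auto simp: indicator_def)
  also have "\<dots> = (\<integral>\<^sup>+s. ennreal (4 * s * (1 - s\<^sup>2) * (?w * s ^ k)) * indicator {0..1} s \<partial>lborel)"
  proof (intro nn_integral_cong)
    fix s :: real
    show "ennreal (4 * s * (1 - s\<^sup>2)) * indicator {0..1} s * (\<integral>\<^sup>+c. indicator {c\<in>space ?N. q c \<le> s} c \<partial>?N)
      = ennreal (4 * s * (1 - s\<^sup>2) * (?w * s ^ k)) * indicator {0..1} s"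
    proof (cases "0 < s \<and> s \<le> 1")
      case True
      then show ?thesis
        using ball[of s] by (simp add: ennreal_mult power_le_one)
    qed (auto simp: indicator_def not_less)
  qed
  also have "\<dots> = ennreal (F 1 - F 0)"
  proof (rule nn_integral_FTC_Icc)
    fix s :: real assume s: "s \<in> {0..1}"
    then show "0 \<le> 4 * s * (1 - s\<^sup>2) * (?w * s ^ k)" by (simp add: power_le_one)
    have "(F has_real_derivative
        4 * ?w * (real (k + 2) * s ^ (k + 1) / real (k + 2) - real (k + 4) * s ^ (k + 3) / real (k + 4))) (at s)"
      unfolding F_def
      by (rule DERIV_cong[OF DERIV_cmult[OF DERIV_diff[OF DERIV_cdivide[OF DERIV_pow] DERIV_cdivide[OF DERIV_pow]]]]) (simp add: add.commute)
    moreover have "4 * ?w * (real (k + 2) * s ^ (k + 1) / real (k + 2) - real (k + 4) * s ^ (k + 3) / real (k + 4))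
        = 4 * s * (1 - s\<^sup>2) * (?w * s ^ k)"
    proof -
      have c: "real (k + 2) * a / real (k + 2) = a" "real (k + 4) * a / real (k + 4) = a" for a
        by (simp_all del: of_nat_add)
      show ?thesis
        unfolding c by (simp add: power_add power2_eq_square power3_eq_cube algebra_simps)
    qed
    ultimately show "(F has_real_derivative 4 * s * (1 - s\<^sup>2) * (?w * s ^ k)) (at s)"
      by (rule DERIV_cong)
  qed auto
  also have "F 1 - F 0 = ?w * (8 / ((real k + 2) * (real k + 4)))"
    unfolding F_def by (simp add: zero_power divide_simps)
  finally have "(\<integral>\<^sup>+c. ennreal ((max 0 (1 - (q c)\<^sup>2))\<^sup>2) \<partial>?N) = ennreal (?w * (8 / ((real k + 2) * (real k + 4))))" .
  then have "(\<integral>c. (max 0 (1 - (q c)\<^sup>2))\<^sup>2 \<partial>?N) = ?w * (8 / ((real k + 2) * (real k + 4)))"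
    by (intro integral_eq_nn_integral[THEN trans]) auto
  then show ?thesis
    unfolding plane_lborel_def q_def by (subst integral_distr[OF meas]) auto
qed

section \<open>The first variation\<close>

text \<open>The Grassmannian carries the topology pulled back along \<open>plane_projection\<close>,
  so continuous functions of the point and the projection are continuous on the varifold
  space.\<close>

lemma borel_measurable_varifold_space:
  fixes g :: "'a::euclidean_space \<times> ('a \<Rightarrow>\<^sub>L 'a) \<Rightarrow> real"
  assumes "continuous_on UNIV g"
  shows "(\<lambda>p. g (fst p, plane_projection (snd p))) \<in> borel_measurable (varifold_space k)"
proof (rule borel_measurableI)
  fix U :: "real set" assume U: "open U"
  have "continuous_map (varifold_topology k) (grassmannian_topology k) (snd :: 'a \<times> 'a set \<Rightarrow> _)"
    unfolding varifold_topology_def by (rule continuous_map_snd)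
  moreover have "continuous_map (grassmannian_topology k) euclidean (plane_projection :: 'a set \<Rightarrow> _)"
    unfolding grassmannian_topology_def
    using continuous_map_pullback[of euclidean euclidean id] by simp
  ultimately have "continuous_map (varifold_topology k) euclidean (plane_projection \<circ> (snd :: 'a \<times> 'a set \<Rightarrow> _))"
    by (rule continuous_map_compose)
  moreover have "continuous_map (varifold_topology k) euclidean (fst :: 'a \<times> 'a set \<Rightarrow> _)"
    unfolding varifold_topology_def by (rule continuous_map_fst)
  ultimately have "continuous_map (varifold_topology k) (prod_topology euclidean euclidean)
      (\<lambda>p :: 'a \<times> 'a set. (fst p, (plane_projection \<circ> snd) p))"
    by (intro continuous_map_pairedI)
  moreover have "continuous_map (prod_topology euclidean euclidean) euclidean g"
    using assms by simp
  ultimately have "continuous_map (varifold_topology k) euclidean (g \<circ> (\<lambda>p :: 'a \<times> 'a set. (fst p, (plane_projection \<circ> snd) p)))"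
    by (rule continuous_map_compose)
  then have "openin (varifold_topology k)
      {p \<in> topspace (varifold_topology k). (g \<circ> (\<lambda>p :: 'a \<times> 'a set. (fst p, (plane_projection \<circ> snd) p))) p \<in> U}"
    using U unfolding continuous_map_def by (simp add: open_openin[symmetric])
  moreover have "(\<lambda>p. g (fst p, plane_projection (snd p))) -` U \<inter> space (varifold_space k)
      = {p \<in> topspace (varifold_topology k). (g \<circ> (\<lambda>p :: 'a \<times> 'a set. (fst p, (plane_projection \<circ> snd) p))) p \<in> U}"
    by (auto simp: space_varifold_space topspace_varifold_topology)
  ultimately show "(\<lambda>p. g (fst p, plane_projection (snd p))) -` U \<inter> space (varifold_space k) \<in> sets (varifold_space k)"
    by (simp add: sets_varifold_space sigma_sets.Basic)
qed

lemma frechet_derivative_expand: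
  fixes X :: "'a::euclidean_space \<Rightarrow> 'a"
  assumes "smooth X"
  shows "frechet_derivative X (at x) v = (\<Sum>b\<in>Basis. (v \<bullet> b) *\<^sub>R frechet_derivative X (at x) b)"
proof -
  interpret linear "frechet_derivative X (at x)"
    using smooth_has_derivative[OF assms] by (rule has_derivative_linear)
  have "frechet_derivative X (at x) v = frechet_derivative X (at x) (\<Sum>b\<in>Basis. (v \<bullet> b) *\<^sub>R b)"
    by (simp add: euclidean_representation)
  then show ?thesis by (simp add: sum scale)
qed

text \<open>The chosen orthonormal basis need not depend measurably on \<open>S\<close>. As a trace
  against the projection, the divergence is visibly continuous in the point and the plane.\<close>

lemma plane_divergence_trace:
  fixes X :: "'a::euclidean_space \<Rightarrow> 'a"
  assumes "smooth X"
  shows "plane_divergence S X x =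
    (\<Sum>b\<in>Basis. \<Sum>c\<in>Basis. (plane_projection S b \<bullet> c) * (frechet_derivative X (at x) c \<bullet> b))"
proof -
  have "(\<Sum>b\<in>Basis. \<Sum>c\<in>Basis. (plane_projection S b \<bullet> c) * (frechet_derivative X (at x) c \<bullet> b))
      = (\<Sum>b\<in>Basis. \<Sum>c\<in>Basis. \<Sum>e\<in>orthonormal_basis S. (e \<bullet> b) * (e \<bullet> c) * (frechet_derivative X (at x) c \<bullet> b))"
    by (simp add: plane_projection_apply inner_sum_left inner_sum_right sum_distrib_left sum_distrib_right inner_commute mult_ac)
  also have "\<dots> = (\<Sum>b\<in>Basis. \<Sum>e\<in>orthonormal_basis S. \<Sum>c\<in>Basis. (e \<bullet> b) * (e \<bullet> c) * (frechet_derivative X (at x) c \<bullet> b))"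
    by (intro sum.cong refl sum.swap)
  also have "\<dots> = (\<Sum>e\<in>orthonormal_basis S. \<Sum>b\<in>Basis. \<Sum>c\<in>Basis. (e \<bullet> b) * (e \<bullet> c) * (frechet_derivative X (at x) c \<bullet> b))"
    by (rule sum.swap)
  also have "\<dots> = (\<Sum>e\<in>orthonormal_basis S. \<Sum>b\<in>Basis. (frechet_derivative X (at x) e \<bullet> b) * (e \<bullet> b))"
    by (subst (2) frechet_derivative_expand[OF assms])
       (simp add: inner_sum_left sum_distrib_left sum_distrib_right mult_ac)
  also have "\<dots> = plane_divergence S X x"
    unfolding plane_divergence_def by (intro sum.cong refl euclidean_inner[symmetric])
  finally show ?thesis ..
qed

lemma plane_divergence_measurable:
  fixes X :: "'a::euclidean_space \<Rightarrow> 'a"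
  assumes "smooth X"
  shows "(\<lambda>(x, S). plane_divergence S X x) \<in> borel_measurable (varifold_space k)"
proof -
  let ?g = "\<lambda>p :: 'a \<times> ('a \<Rightarrow>\<^sub>L 'a). \<Sum>b\<in>Basis. \<Sum>c\<in>Basis.
      (blinfun_apply (snd p) b \<bullet> c) * (frechet_derivative X (at (fst p)) c \<bullet> b)"
  have "continuous_on UNIV (\<lambda>x. frechet_derivative X (at x) c)" for c
    by (intro smooth_continuous smooth_frechet_derivative assms)
  then have "continuous_on UNIV (\<lambda>p :: 'a \<times> ('a \<Rightarrow>\<^sub>L 'a). frechet_derivative X (at (fst p)) c)" for c
    by (rule continuous_on_compose2) (auto intro: continuous_intros)
  then have "continuous_on UNIV ?g"
    by (intro continuous_intros)
  from borel_measurable_varifold_space[OF this] show ?thesis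
    by (simp add: plane_divergence_trace[OF assms] split_beta)
qed

lemma plane_divergence_bounded:
  fixes X :: "'a::euclidean_space \<Rightarrow> 'a"
  assumes "smooth X"
  obtains K where "\<And>x S. x \<in> cball 0 1 \<Longrightarrow> S \<in> grassmannian k \<Longrightarrow> \<bar>plane_divergence S X x\<bar> \<le> K"
proof -
  let ?n = "\<lambda>x. \<Sum>b\<in>Basis. norm (frechet_derivative X (at x) b)"
  have "continuous_on UNIV (\<lambda>x. frechet_derivative X (at x) c)" for c
    by (intro smooth_continuous smooth_frechet_derivative assms)
  then have "continuous_on UNIV ?n" by (intro continuous_intros)
  then have "continuous_on (cball 0 1) ?n" by (rule continuous_on_subset) simp
  then have "bounded (?n ` cball 0 1)"
    by (intro compact_imp_bounded compact_continuous_image compact_cball)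
  then obtain K where "\<forall>u\<in>?n ` cball 0 1. norm u \<le> K" unfolding bounded_iff by blast
  then have K: "?n x \<le> K" if "x \<in> cball 0 1" for x
  proof -
    have "norm (?n x) \<le> K" using \<open>\<forall>u\<in>?n ` cball 0 1. norm u \<le> K\<close> that by blast
    then show ?thesis by simp
  qed
  have "\<bar>plane_divergence S X x\<bar> \<le> real k * K" if "x \<in> cball 0 1" and S: "S \<in> grassmannian k" for x S
  proof -
    have "\<bar>frechet_derivative X (at x) e \<bullet> e\<bar> \<le> K" if e: "e \<in> orthonormal_basis S" for e
    proof -
      have ne: "norm e = 1" using inner_orthonormal_basis[OF S e] by (simp add: norm_eq_1)
      have "\<bar>frechet_derivative X (at x) e \<bullet> e\<bar> \<le> norm (frechet_derivative X (at x) e) * norm e"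
        by (rule Cauchy_Schwarz_ineq2)
      also have "\<dots> = norm (\<Sum>b\<in>Basis. (e \<bullet> b) *\<^sub>R frechet_derivative X (at x) b)"
        using frechet_derivative_expand[OF assms, of x e] ne by simp
      also have "\<dots> \<le> (\<Sum>b\<in>Basis. norm ((e \<bullet> b) *\<^sub>R frechet_derivative X (at x) b))"
        by (rule norm_sum)
      also have "\<dots> \<le> ?n x"
        using Basis_le_norm[of _ e] ne by (intro sum_mono) (simp add: mult_left_le_one_le)
      also have "\<dots> \<le> K" using K \<open>x \<in> cball 0 1\<close> by simp
      finally show ?thesis .
    qed
    then have "\<bar>plane_divergence S X x\<bar> \<le> (\<Sum>e\<in>orthonormal_basis S. K)"
      unfolding plane_divergence_def by (intro order_trans[OF sum_abs] sum_mono)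
    then show ?thesis by (simp add: card_orthonormal_basis[OF S])
  qed
  then show thesis using that by blast
qed

section \<open>Finite stationary varifolds carried by the closed ball\<close>

locale ball_varifold = finite_measure V
  for V :: "('a::euclidean_space \<times> 'a set) measure" +
  fixes k :: nat
  assumes k: "1 \<le> k" and sets_V: "sets V = sets (varifold_space k)"
    and AE_ball: "AE p in V. fst p \<in> cball 0 1"
    and stationary: "free_boundary_stationary V"
begin

lemma space_V: "space V = UNIV \<times> grassmannian k"
  using sets_eq_imp_space_eq[OF sets_V] by (simp add: space_varifold_space)

lemma measurable_V: "f \<in> borel_measurable (varifold_space k) \<Longrightarrow> f \<in> borel_measurable V"
  using measurable_cong_sets[OF sets_V refl] by blast

lemma integrable_bounded:
  assumes "f \<in> borel_measurable (varifold_space k)"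
    and "\<And>x S. x \<in> cball 0 1 \<Longrightarrow> S \<in> grassmannian k \<Longrightarrow> \<bar>f (x, S)\<bar> \<le> (K :: real)"
  shows "integrable V f"
proof (rule integrable_const_bound)
  have "AE p in V. p \<in> space V" by simp
  with AE_ball show "AE p in V. norm (f p) \<le> K"
    by eventually_elim (use assms(2) in \<open>auto simp: space_V\<close>)
qed (rule measurable_V[OF assms(1)])

lemma integrable_continuous:
  fixes g :: "'a \<Rightarrow> real"
  assumes "continuous_on UNIV g"
  shows "integrable V (\<lambda>p. g (fst p))"
proof -
  have "bounded (g ` cball 0 1)"
    by (intro compact_imp_bounded compact_continuous_image compact_cball continuous_on_subset[OF assms]) simp
  then obtain K where K: "\<forall>u\<in>g ` cball 0 1. norm u \<le> K" unfolding bounded_iff by blast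
  show ?thesis
    by (rule integrable_bounded[of _ K])
       (use K measurable_compose[OF measurable_fst_varifold_space borel_measurable_continuous_onI[OF assms]] in auto)
qed

text \<open>A Bochner integral is 0 by default when the integrand is not integrable, so the
  vanishing is informative only together with integrability.\<close>

lemma first_variation:
  assumes "smooth X" "\<And>p. p \<in> sphere 0 1 \<Longrightarrow> X p \<bullet> p = 0"
  shows "integrable V (\<lambda>(x, S). plane_divergence S X x)" "(\<integral>(x, S). plane_divergence S X x \<partial>V) = 0"
proof -
  obtain K where "\<And>x S. x \<in> cball 0 1 \<Longrightarrow> S \<in> grassmannian k \<Longrightarrow> \<bar>plane_divergence S X x\<bar> \<le> K"
    using plane_divergence_bounded[OF assms(1)] by blast
  then show "integrable V (\<lambda>(x, S). plane_divergence S X x)"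
    by (intro integrable_bounded[of _ K] plane_divergence_measurable[OF assms(1)]) auto
  show "(\<integral>(x, S). plane_divergence S X x \<partial>V) = 0"
    using stationary assms unfolding free_boundary_stationary_def by blast
qed

definition perp_sq :: "'a \<Rightarrow> 'a \<times> 'a set \<Rightarrow> real" where
  "perp_sq y p = (norm ((fst p - y) - plane_projection (snd p) (fst p - y)))\<^sup>2"

lemma integrable_perp_sq: "integrable V (perp_sq y)"
proof (rule integrable_bounded)
  have "continuous_on UNIV (\<lambda>p :: 'a \<times> ('a \<Rightarrow>\<^sub>L 'a). (norm ((fst p - y) - blinfun_apply (snd p) (fst p - y)))\<^sup>2)"
    by (intro continuous_intros)
  from borel_measurable_varifold_space[OF this]
  show "perp_sq y \<in> borel_measurable (varifold_space k)"
    by (simp add: perp_sq_def[abs_def])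
  fix x :: 'a and S :: "'a set" assume x: "x \<in> cball 0 1" and S: "S \<in> grassmannian k"
  have "perp_sq y (x, S) \<le> (norm (x - y))\<^sup>2"
    unfolding perp_sq_def fst_conv snd_conv norm_diff_plane_projection[OF S]
    using inner_plane_projection_nonneg[OF S, of "x - y"] by (simp add: power2_norm_eq_inner)
  also have "\<dots> \<le> (1 + norm y)\<^sup>2"
    using x norm_triangle_ineq4[of x y] by (intro power_mono) auto
  finally show "\<bar>perp_sq y (x, S)\<bar> \<le> (1 + norm y)\<^sup>2" by (simp add: perp_sq_def)
qed

definition bump :: "'a \<Rightarrow> real" where "bump z = (max 0 (1 - (norm z)\<^sup>2))\<^sup>2"

text \<open>A continuous, compactly supported majorant of the indicator of
  \<open>norm z < 2\<close>, to which the convergence of blow-ups applies.\<close>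

definition tent :: "'a \<Rightarrow> real" where "tent z = max 0 (3 - norm z)"

lemma continuous_bump: "continuous_on S bump" and continuous_tent: "continuous_on S tent"
  unfolding bump_def tent_def by (auto intro!: continuous_intros)

text \<open>The divergence bound of \<open>ex_test_field\<close> at scale \<open>r\<close> is
  integrated against \<open>V\<close>, where the left side gives 0. The approximation error
  disappears at fixed \<open>r\<close>, before any limit in \<open>r\<close>.\<close>

lemma monotonicity_ineq:
  assumes y: "norm y \<le> 1" and r: "0 < r" "r < 1"
  shows "real k * ((real k + 2) * (real k + 4) / 8) * ((\<integral>p. bump ((fst p - y) /\<^sub>R r) \<partial>V) / r ^ k)
      + real k * 4 powr (- real k / 2 - 1) * (\<integral>p. perp_sq y p \<partial>V)
    \<le> real k * measure V (space V)
      + 2 * (real k + 8) * (1 + real k)\<^sup>2 * (r * ((\<integral>p. tent ((fst p - y) /\<^sub>R r) \<partial>V) / r ^ k))"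
    (is "?a * (?B / _) + ?c * ?Q \<le> real k * ?M + ?d * (r * (?T / _))")
proof (rule field_le_epsilon)
  fix \<epsilon> :: real assume \<epsilon>: "0 < \<epsilon>"
  let ?e = "\<epsilon> / (1 + ?M)"
  have M: "0 < 1 + ?M" by (simp add: add_pos_nonneg)
  then have e: "0 < ?e" using \<epsilon> by simp
  obtain X where X: "smooth X" "\<And>p. p \<in> sphere 0 1 \<Longrightarrow> X p \<bullet> p = 0"
    "\<And>x S. x \<in> cball 0 1 \<Longrightarrow> S \<in> grassmannian k \<Longrightarrow> plane_divergence S X x \<le> real k + ?e
      - ?a * ((max 0 (1 - (norm ((x - y) /\<^sub>R r))\<^sup>2))\<^sup>2 / r ^ k)
      - ?c * (norm ((x - y) - plane_projection S (x - y)))\<^sup>2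
      + (if norm ((x - y) /\<^sub>R r) < 2 then ?d * (r / r ^ k) else 0)"
    using ex_test_field[OF k y r e] by blast
  have cont: "continuous_on UNIV (\<lambda>x. h ((x - y) /\<^sub>R r))" if "continuous_on UNIV h" for h :: "'a \<Rightarrow> real"
    by (rule continuous_on_compose2[OF that]) (auto intro!: continuous_intros)
  note int = integrable_continuous[OF cont[OF continuous_bump]] integrable_continuous[OF cont[OF continuous_tent]]
    integrable_perp_sq[of y]
  have "0 = (\<integral>(x, S). plane_divergence S X x \<partial>V)"
    using first_variation[OF X(1,2)] by simp
  also have "\<dots> \<le> (\<integral>p. real k + ?e - ?a / r ^ k * bump ((fst p - y) /\<^sub>R r) - ?c * perp_sq y p
      + ?d * r / r ^ k * tent ((fst p - y) /\<^sub>R r) \<partial>V)"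
  proof (rule integral_mono_AE)
    show "integrable V (\<lambda>(x, S). plane_divergence S X x)" by (rule first_variation[OF X(1,2)])
    show "integrable V (\<lambda>p. real k + ?e - ?a / r ^ k * bump ((fst p - y) /\<^sub>R r) - ?c * perp_sq y p
      + ?d * r / r ^ k * tent ((fst p - y) /\<^sub>R r))"
      using int by simp
    have "AE p in V. p \<in> space V" by simp
    with AE_ball show "AE p in V. (case p of (x, S) \<Rightarrow> plane_divergence S X x)
      \<le> real k + ?e - ?a / r ^ k * bump ((fst p - y) /\<^sub>R r) - ?c * perp_sq y p
        + ?d * r / r ^ k * tent ((fst p - y) /\<^sub>R r)"
    proof eventually_elim
      case (elim p)
      obtain x S where p: "p = (x, S)" by (cases p)
      have S: "S \<in> grassmannian k" and x: "x \<in> cball 0 1" using elim by (auto simp: p space_V)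
      have "(if norm ((x - y) /\<^sub>R r) < 2 then 1 else 0) \<le> tent ((x - y) /\<^sub>R r)"
        by (auto simp: tent_def)
      then have "?d * r / r ^ k * (if norm ((x - y) /\<^sub>R r) < 2 then 1 else 0) \<le> ?d * r / r ^ k * tent ((x - y) /\<^sub>R r)"
        using r by (intro mult_left_mono) auto
      moreover have "?d * r / r ^ k * (if norm ((x - y) /\<^sub>R r) < 2 then 1 else 0)
          = (if norm ((x - y) /\<^sub>R r) < 2 then ?d * (r / r ^ k) else 0)" by simp
      moreover have "?a * ((max 0 (1 - (norm ((x - y) /\<^sub>R r))\<^sup>2))\<^sup>2 / r ^ k) = ?a / r ^ k * bump ((x - y) /\<^sub>R r)"
        by (simp add: bump_def)
      ultimately show ?case
        using X(3)[OF x S] unfolding p by (simp only: perp_sq_def fst_conv snd_conv prod.case)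
    qed
  qed
  also have "\<dots> = (real k + ?e) * ?M - ?a / r ^ k * ?B - ?c * ?Q + ?d * r / r ^ k * ?T"
    using int by (simp add: algebra_simps)
  finally have "?a / r ^ k * ?B + ?c * ?Q \<le> real k * ?M + ?d * r / r ^ k * ?T + ?e * ?M"
    by (simp add: algebra_simps)
  moreover have "?e * ?M \<le> \<epsilon>" using \<epsilon> M by (simp add: field_simps)
  ultimately show "?a * (?B / r ^ k) + ?c * ?Q \<le> real k * ?M + ?d * (r * (?T / r ^ k)) + \<epsilon>"
    by simp
qed

text \<open>As \<open>r\<close> tends to 0 the tent quotient stays convergent, so its additional
  factor \<open>r\<close> removes the error term. In the application \<open>L\<close> is the
  integral over the approximate tangent plane and \<open>c\<close> the multiplicity.\<close>

lemma density_ineq: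
  assumes y: "norm y \<le> 1"
    and lim: "\<And>f. continuous_on UNIV f \<Longrightarrow> compact (closure {z. f z \<noteq> 0}) \<Longrightarrow>
      ((\<lambda>r. (\<integral>p. f ((fst p - y) /\<^sub>R r) \<partial>V) / r ^ k) \<longlongrightarrow> c * L f) (at_right 0)"
  shows "real k * ((real k + 2) * (real k + 4) / 8) * (c * L bump)
      + real k * 4 powr (- real k / 2 - 1) * (\<integral>p. perp_sq y p \<partial>V) \<le> real k * measure V (space V)"
proof -
  have comp: "compact (closure {z. f z \<noteq> 0})" if "\<And>z. f z \<noteq> 0 \<Longrightarrow> norm z \<le> 3" for f :: "'a \<Rightarrow> real"
    by (auto simp: intro!: bounded_subset[OF bounded_cball[of 0 3]] that)
  have b: "((\<lambda>r. (\<integral>p. bump ((fst p - y) /\<^sub>R r) \<partial>V) / r ^ k) \<longlongrightarrow> c * L bump) (at_right 0)"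
  proof (rule lim[OF continuous_bump comp])
    fix z :: 'a assume "bump z \<noteq> 0"
    then have "(norm z)\<^sup>2 < 1\<^sup>2" by (auto simp: bump_def max_def split: if_splits)
    then have "norm z < 1" by (rule power2_less_imp_less) simp
    then show "norm z \<le> 3" by simp
  qed
  have t: "((\<lambda>r. (\<integral>p. tent ((fst p - y) /\<^sub>R r) \<partial>V) / r ^ k) \<longlongrightarrow> c * L tent) (at_right 0)"
    by (rule lim[OF continuous_tent comp]) (auto simp: tent_def max_def split: if_splits)
  have r0: "((\<lambda>r::real. r) \<longlongrightarrow> 0) (at_right 0)" by (rule tendsto_ident_at)
  have "eventually (\<lambda>r::real. r \<in> {0<..<1}) (at_right 0)"
    by (rule eventually_at_right_real) simp
  then have ev: "eventually (\<lambda>r. real k * ((real k + 2) * (real k + 4) / 8) * ((\<integral>p. bump ((fst p - y) /\<^sub>R r) \<partial>V) / r ^ k)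
      + real k * 4 powr (- real k / 2 - 1) * (\<integral>p. perp_sq y p \<partial>V)
    \<le> real k * measure V (space V)
      + 2 * (real k + 8) * (1 + real k)\<^sup>2 * (r * ((\<integral>p. tent ((fst p - y) /\<^sub>R r) \<partial>V) / r ^ k))) (at_right 0)"
    by eventually_elim (rule monotonicity_ineq[OF y], auto)
  have "real k * ((real k + 2) * (real k + 4) / 8) * (c * L bump)
      + real k * 4 powr (- real k / 2 - 1) * (\<integral>p. perp_sq y p \<partial>V)
    \<le> real k * measure V (space V) + 2 * (real k + 8) * (1 + real k)\<^sup>2 * (0 * (c * L tent))"
    by (rule tendsto_le[OF trivial_limit_at_right_real _ _ ev])
       (intro tendsto_intros b t r0)+
  then show ?thesis by simp
qed

end

section \<open>Density, mass and the equality case\<close>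

lemma AE_imp_ex:
  assumes "AE x in M. P x" "emeasure M (space M) \<noteq> 0"
  shows "\<exists>x\<in>space M. P x"
proof (rule ccontr)
  assume *: "\<not> ?thesis"
  from assms(1) obtain N where N: "{x \<in> space M. \<not> P x} \<subseteq> N" "emeasure M N = 0" "N \<in> sets M"
    by (rule AE_E)
  then have "space M \<subseteq> N" using * by auto
  then have "emeasure M (space M) \<le> emeasure M N" using N by (intro emeasure_mono)
  then show False using assms(2) N by simp
qed

text \<open>The complement of the support is a union of null balls, which the Lindelof property
  makes countable.\<close>

lemma AE_measure_support:
  fixes \<mu> :: "'a::euclidean_space measure"
  assumes sets: "sets \<mu> = sets borel"
  shows "AE x in \<mu>. x \<in> measure_support \<mu>"
proof -
  define \<F> where "\<F> = {ball x r | x r. 0 < r \<and> emeasure \<mu> (ball x r) = 0}"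
  have op: "\<And>B. B \<in> \<F> \<Longrightarrow> open B" by (auto simp: \<F>_def)
  obtain \<F>' where F': "\<F>' \<subseteq> \<F>" "countable \<F>'" "\<Union>\<F>' = \<Union>\<F>"
    by (rule Lindelof[OF op])
  have "(\<Union>B\<in>\<F>'. B) \<in> null_sets \<mu>"
    using F'(1,2) by (intro null_sets_UN') (auto simp: \<F>_def null_sets_def sets)
  then show ?thesis
  proof (rule AE_I')
    have "x \<in> \<Union>\<F>" if x: "x \<notin> measure_support \<mu>" for x
    proof -
      obtain r where "0 < r" "emeasure \<mu> (ball x r) = 0"
        using x by (auto simp: measure_support_def not_gr_zero)
      then have "ball x r \<in> \<F>" "x \<in> ball x r" by (auto simp: \<F>_def)
      then show ?thesis by blast
    qed
    then show "{x \<in> space \<mu>. x \<notin> measure_support \<mu>} \<subseteq> (\<Union>B\<in>\<F>'. B)"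
      using F'(3) by auto
  qed
qed

lemma
  assumes "sets V = sets (varifold_space k)"
  shows sets_weight: "sets (weight V) = sets borel"
    and mass_eq_emeasure_space: "mass V = emeasure V (space V)"
    and AE_weightD: "(AE x in weight V. P x) \<Longrightarrow> (AE p in V. P (fst p))"
proof -
  have m: "fst \<in> V \<rightarrow>\<^sub>M borel"
    using measurable_fst_varifold_space measurable_cong_sets[OF assms refl] by blast
  show "sets (weight V) = sets borel" by (simp add: weight_def)
  show "mass V = emeasure V (space V)"
    unfolding mass_def weight_def by (subst emeasure_distr[OF m]) auto
  show "(AE x in weight V. P x) \<Longrightarrow> (AE p in V. P (fst p))"
    unfolding weight_def by (rule AE_distrD[OF m])
qed

lemma plane_projection_ident:
  assumes S: "S \<in> grassmannian k" and v: "v \<in> S"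
  shows "plane_projection S v = v"
proof -
  have sub: "subspace S" using S by (auto simp: grassmannian_def)
  show ?thesis
    unfolding plane_projection_apply
    using orthonormal_basis(2,3,6)[OF sub] v finite_orthonormal_basis[OF S]
    by (intro orthonormal_basis_expand) auto
qed

context ball_varifold
begin

lemma subset_subspace_of_ae:
  assumes ne: "emeasure V (space V) \<noteq> 0"
    and supp: "AE p in V. fst p \<in> Y"
    and diff: "AE p in V. \<forall>z\<in>Y. fst p - z \<in> snd p"
  shows "\<exists>P. subspace P \<and> dim P = k \<and> Y \<subseteq> P"
proof -
  define H where "H = affine hull Y"
  have "\<exists>p\<in>space V. fst p \<in> Y" by (rule AE_imp_ex[OF supp ne])
  then have H: "affine H" "closed H" "H \<noteq> {}"
    by (auto simp: H_def)
  define w where "w = closest_point H 0"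
  have wH: "w \<in> H" unfolding w_def by (rule closest_point_in_set[OF H(2,3)])
  have ge: "0 \<le> w \<bullet> (u - w)" if "u \<in> H" for u
    using closest_point_dot[OF affine_imp_convex[OF H(1)] H(2) that, of 0] by (simp add: w_def)
  have orth: "w \<bullet> (u - w) = 0" if u: "u \<in> H" for u
  proof -
    \<comment> \<open>The reflection of \<open>u\<close> in \<open>w\<close> stays in the affine set
      and reverses the sign, so the inequality for the nearest point becomes an equality.\<close>
    have "2 *\<^sub>R w + (- 1) *\<^sub>R u \<in> H" by (rule mem_affine[OF H(1) wH u]) simp
    from ge[OF this] ge[OF u] show ?thesis by (simp add: inner_diff_right algebra_simps)
  qed
  have AE1: "AE p in V. snd p \<in> grassmannian k \<and> fst p \<in> H \<and> (\<forall>z\<in>H. fst p - z \<in> snd p)"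
  proof -
    have "AE p in V. p \<in> space V" by simp
    with supp diff show ?thesis
    proof eventually_elim
      case (elim p)
      then have S: "snd p \<in> grassmannian k" by (auto simp: space_V)
      then have sub: "subspace (snd p)" by (simp add: grassmannian_def)
      \<comment> \<open>For fixed \<open>p\<close> the condition on z is affine and hence passes
        from \<open>Y\<close> to its affine hull.\<close>
      have "affine {z. fst p - z \<in> snd p}"
        unfolding affine_def
      proof (intro ballI allI impI)
        fix a b and u v :: real
        assume "a \<in> {z. fst p - z \<in> snd p}" "b \<in> {z. fst p - z \<in> snd p}" and uv: "u + v = 1"
        then have "u *\<^sub>R (fst p - a) + v *\<^sub>R (fst p - b) \<in> snd p"
          using sub by (intro subspace_add subspace_scale) auto
        moreover have "u *\<^sub>R (fst p - a) + v *\<^sub>R (fst p - b) = fst p - (u *\<^sub>R a + v *\<^sub>R b)"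
          using uv by (simp add: algebra_simps flip: scaleR_add_left)
        ultimately show "u *\<^sub>R a + v *\<^sub>R b \<in> {z. fst p - z \<in> snd p}" by simp
      qed
      then have "H \<subseteq> {z. fst p - z \<in> snd p}"
        unfolding H_def using elim by (intro hull_minimal) auto
      then show ?case using S elim by (auto simp: H_def hull_inc)
    qed
  qed
  \<comment> \<open>The projection to the tangent space on the sphere of the constant field
    \<open>w\<close>. On \<open>H\<close> one has \<open>w \<bullet> x = w \<bullet> w\<close>, and
    \<open>x - w\<close> lies in the plane and is orthogonal to \<open>w\<close>; this makes the
    divergence at most \<open>- k * (w \<bullet> w)\<close>.\<close>
  define X where "X x = w - (w \<bullet> x) *\<^sub>R x" for x
  have sX: "smooth X" unfolding X_def[abs_def] by (intro smooth_intros)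
  have tX: "X p \<bullet> p = 0" if "p \<in> sphere 0 1" for p
    using that by (simp add: X_def inner_diff_left norm_eq_1)
  have "0 = (\<integral>(x, S). plane_divergence S X x \<partial>V)"
    using first_variation[OF sX tX] by simp
  also have "\<dots> \<le> (\<integral>p. - (real k * (w \<bullet> w)) \<partial>V)"
  proof (rule integral_mono_AE)
    show "integrable V (\<lambda>(x, S). plane_divergence S X x)" by (rule first_variation[OF sX tX])
    show "AE p in V. (case p of (x, S) \<Rightarrow> plane_divergence S X x) \<le> - (real k * (w \<bullet> w))"
      using AE1
    proof eventually_elim
      case (elim p)
      obtain x S where p: "p = (x, S)" by (cases p)
      have S: "S \<in> grassmannian k" and x: "x \<in> H" and l: "x - w \<in> S" using elim wH by (auto simp: p)
      have "(X has_derivative (\<lambda>h. - ((w \<bullet> x) *\<^sub>R h + (w \<bullet> h) *\<^sub>R x))) (at x)"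
        unfolding X_def[abs_def] by (auto intro!: derivative_eq_intros)
      from plane_divergence_eq[OF this, of S]
      have "plane_divergence S X x = (\<Sum>e\<in>orthonormal_basis S. - ((w \<bullet> x) + (w \<bullet> e) * (x \<bullet> e)))"
        using inner_orthonormal_basis[OF S] by (simp add: inner_add_left inner_diff_left cong: sum.cong)
      also have "\<dots> = - (\<Sum>e\<in>orthonormal_basis S. (w \<bullet> x) + (w \<bullet> e) * (x \<bullet> e))"
        by (rule sum_negf)
      also have "\<dots> = - (real k * (w \<bullet> x)) - w \<bullet> plane_projection S x"
        by (simp add: sum.distrib card_orthonormal_basis[OF S] inner_plane_projection)
      also have "w \<bullet> x = w \<bullet> w" using orth[OF x] by (simp add: inner_diff_right)
      also have "w \<bullet> plane_projection S x = w \<bullet> plane_projection S w"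
      proof -
        have "w \<bullet> plane_projection S (x - w) = 0"
          unfolding plane_projection_ident[OF S l] by (rule orth[OF x])
        then show ?thesis by (simp add: blinfun.diff_right inner_diff_right)
      qed
      finally show ?case using inner_plane_projection_nonneg[OF S, of w] by (simp add: p)
    qed
  qed simp
  finally have "real k * (w \<bullet> w) * measure V (space V) \<le> 0" by (simp add: mult_ac)
  moreover have "0 < measure V (space V)"
    using ne by (simp add: measure_eq_emeasure_eq_ennreal emeasure_eq_measure zero_less_measure_iff)
  ultimately have "w \<bullet> w \<le> 0" using k by (simp add: mult_le_0_iff)
  then have "w = 0" using inner_ge_zero[of w] by (metis inner_eq_zero_iff order_antisym)
  then have 0: "0 \<in> H" using wH by simp
  \<comment> \<open>The plane of a single typical \<open>p\<close> contains \<open>Y\<close>: taking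
    z = 0 puts \<open>fst p\<close> into it, and then each z follows by subtraction.\<close>
  obtain p where p: "snd p \<in> grassmannian k" "\<forall>z\<in>H. fst p - z \<in> snd p"
    using AE_imp_ex[OF AE1 ne] by blast
  have sub: "subspace (snd p)" "dim (snd p) = k" using p(1) by (auto simp: grassmannian_def)
  have "fst p \<in> snd p" using p(2) 0 by force
  have "Y \<subseteq> snd p"
  proof
    fix z assume "z \<in> Y"
    then have "fst p - z \<in> snd p" using p(2) by (simp add: H_def hull_inc)
    then have "fst p - (fst p - z) \<in> snd p"
      by (rule subspace_diff[OF sub(1) \<open>fst p \<in> snd p\<close>])
    then show "z \<in> snd p" by simp
  qed
  then show ?thesis using sub by blast
qed

text \<open>The bump integral cancels the normalising factor, leaving the volume of the unit ball,
  and \<open>1 \<le> c\<close> discards the multiplicity. The tangent plane belongs to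
  \<open>\<mu>\<close> and the first variation to \<open>V\<close>; the last hypothesis links
  them.\<close>

lemma density_mass_ineq:
  assumes y: "norm y \<le> 1" and c: "1 \<le> c"
    and tangent: "approx_tangent_plane k \<mu> y c P"
    and \<mu>: "\<And>f :: 'a \<Rightarrow> real. continuous_on UNIV f \<Longrightarrow> (\<integral>p. f (fst p) \<partial>V) = (\<integral>x. f x \<partial>\<mu>)"
  shows "real k * unit_ball_vol (real k)
      + real k * 4 powr (- real k / 2 - 1) * (\<integral>p. perp_sq y p \<partial>V) \<le> real k * measure V (space V)"
proof -
  have P: "P \<in> grassmannian k"
    and lim: "\<And>f :: 'a \<Rightarrow> real. continuous_on UNIV f \<Longrightarrow> compact (closure {z. f z \<noteq> 0}) \<Longrightarrow>
      ((\<lambda>r. (\<integral>x. f ((x - y) /\<^sub>R r) \<partial>\<mu>) / r ^ k) \<longlongrightarrow> c * (\<integral>z. f z \<partial>plane_lborel P)) (at_right 0)"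
    using tangent unfolding approx_tangent_plane_def by blast+
  have eq: "(\<integral>x. f ((x - y) /\<^sub>R r) \<partial>\<mu>) = (\<integral>p. f ((fst p - y) /\<^sub>R r) \<partial>V)" if "continuous_on UNIV f" for f :: "'a \<Rightarrow> real" and r
    by (rule \<mu>[symmetric], rule continuous_on_compose2[OF that]) (auto intro!: continuous_intros)
  have "real k * ((real k + 2) * (real k + 4) / 8) * (c * (\<integral>z. bump z \<partial>plane_lborel P))
      + real k * 4 powr (- real k / 2 - 1) * (\<integral>p. perp_sq y p \<partial>V) \<le> real k * measure V (space V)"
    by (rule density_ineq[OF y]) (use lim eq in simp)
  moreover have "(real k + 2) * (real k + 4) / 8 * (\<integral>z. bump z \<partial>plane_lborel P) = unit_ball_vol (real k)"
  proof -
    have "real k + 2 \<noteq> 0" "real k + 4 \<noteq> 0" by auto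
    then show ?thesis unfolding bump_def integral_bump_plane[OF P k] by simp
  qed
  then have "real k * ((real k + 2) * (real k + 4) / 8) * (c * (\<integral>z. bump z \<partial>plane_lborel P))
      = c * (real k * unit_ball_vol (real k))"
    by (simp add: mult_ac)
  moreover have "1 * (real k * unit_ball_vol (real k)) \<le> c * (real k * unit_ball_vol (real k))"
    using c by (intro mult_right_mono) auto
  ultimately show ?thesis by linarith
qed

end

theorem theorem4p4:
  fixes V :: "('a::euclidean_space \<times> 'a set) measure" and k :: nat
  assumes "1 \<le> k" and "k \<le> DIM('a)"
    and "integral_varifold k V"
    and "measure_support (weight V) \<subseteq> cball 0 1"
    and "free_boundary_stationary V"
    and "V \<noteq> null_measure (varifold_space k)"
  shows "mass V \<ge> ennreal (unit_ball_vol (real k)) \<and>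
    (mass V = ennreal (unit_ball_vol (real k)) \<longrightarrow>
       (\<exists>P. subspace P \<and> dim P = k \<and> measure_support (weight V) \<subseteq> P))"
proof -
  let ?w = "unit_ball_vol (real k)" and ?Y = "measure_support (weight V)"
  have sets: "sets V = sets (varifold_space k)"
    using assms(3) by (simp add: integral_varifold_def varifold_def)
  note weight = sets_weight[OF sets] mass_eq_emeasure_space[OF sets] AE_weightD[OF sets]
  show ?thesis
  \<comment> \<open>For infinite mass the bound is trivial and equality impossible.\<close>
  proof (cases "emeasure V (space V) = \<infinity>")
    case True
    then show ?thesis by (simp add: weight(2))
  next
    case False
    interpret finite_measure V by (rule finite_measureI[OF False])
    have supp: "AE p in V. fst p \<in> ?Y"
      by (intro weight(3) AE_measure_support weight(1))
    have "AE p in V. fst p \<in> cball 0 1"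
      using supp by eventually_elim (use assms(4) in blast)
    then interpret ball_varifold V k
      using assms(1,5) sets by unfold_locales
    have ne: "emeasure V (space V) \<noteq> 0"
    proof
      assume 0: "emeasure V (space V) = 0"
      have "V = null_measure (varifold_space k)"
      proof (rule measure_eqI)
        fix A assume "A \<in> sets V"
        then show "emeasure V A = emeasure (null_measure (varifold_space k)) A"
          using emeasure_mono[OF sets.sets_into_space[of A V] sets.top] 0 by simp
      qed (simp add: sets)
      then show False using assms(6) by simp
    qed
    from assms(3) obtain M \<theta> T \<mu> where M: "M \<in> sets (hausdorff k)" and \<theta>: "\<forall>x\<in>M. 0 < \<theta> x"
      and T: "(\<lambda>x. (x, T x)) \<in> restrict_space (hausdorff k) M \<rightarrow>\<^sub>M varifold_space k"
      and \<mu>: "\<mu> = density (restrict_space (hausdorff k) M) (\<lambda>x. of_nat (\<theta> x))"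
      and tangent: "AE x in \<mu>. approx_tangent_plane k \<mu> x (real (\<theta> x)) (T x)"
      and V: "V = distr \<mu> (varifold_space k) (\<lambda>x. (x, T x))"
      unfolding integral_varifold_def Let_def by blast
    have T\<mu>: "(\<lambda>x. (x, T x)) \<in> \<mu> \<rightarrow>\<^sub>M varifold_space k"
      using T by (simp add: \<mu>)
    have id\<mu>: "(\<lambda>x. x) \<in> \<mu> \<rightarrow>\<^sub>M borel"
      using measurable_compose[OF T\<mu> measurable_fst_varifold_space] by simp
    have space_\<mu>: "space \<mu> = M" using M by (simp add: \<mu> space_restrict_space2)
    have W: "weight V = distr \<mu> borel (\<lambda>x. x)"
      unfolding weight_def V by (subst distr_distr[OF measurable_fst_varifold_space T\<mu>]) (simp add: comp_def)
    have int: "(\<integral>p. f (fst p) \<partial>V) = (\<integral>x. f x \<partial>\<mu>)" if "continuous_on UNIV f" for f :: "'a \<Rightarrow> real"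
      unfolding V
      using integral_distr[OF T\<mu> measurable_compose[OF measurable_fst_varifold_space
            borel_measurable_continuous_onI[OF that]]] by simp
    \<comment> \<open>The points at which the density inequality can be centred; almost every point
      is one.\<close>
    define Z where "Z = {y\<in>M. norm y \<le> 1 \<and> approx_tangent_plane k \<mu> y (real (\<theta> y)) (T y)}"
    have AE_Z: "AE x in \<mu>. x \<in> Z"
    proof -
      have "AE x in \<mu>. fst (x, T x) \<in> cball 0 1"
        by (rule AE_distrD[OF T\<mu>], subst V[symmetric], rule AE_ball)
      moreover have "AE x in \<mu>. x \<in> space \<mu>" by simp
      ultimately show ?thesis
        using tangent by eventually_elim (auto simp: Z_def space_\<mu>)
    qed
    have Z_ineq: "real k * ?w + real k * 4 powr (- real k / 2 - 1) * (\<integral>p. perp_sq y p \<partial>V)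
        \<le> real k * measure V (space V)" if "y \<in> Z" for y
      using that \<theta> density_mass_ineq[OF _ _ _ int, of y "real (\<theta> y)" "T y"]
      by (auto simp: Z_def Suc_le_eq)
    have perp_nonneg: "0 \<le> (\<integral>p. perp_sq y p \<partial>V)" for y
      by (simp add: perp_sq_def)
    have mass: "mass V = ennreal (measure V (space V))"
      by (simp add: weight(2) emeasure_eq_measure)
    \<comment> \<open>This gives both a first centre for the mass bound and the density of
      \<open>Z\<close> in the support.\<close>
    have ex_Z: "\<exists>z\<in>Z. z \<in> U" if "open U" "0 < emeasure (weight V) U" for U
    proof (rule ccontr)
      assume *: "\<not> ?thesis"
      have U: "U \<in> sets borel" using \<open>open U\<close> by simp
      have "AE x in \<mu>. x \<notin> U" using AE_Z by eventually_elim (use * in auto)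
      then have "AE x in weight V. x \<notin> U"
        unfolding W using U by (subst AE_distr_iff[OF id\<mu>]) auto
      then have "emeasure (weight V) U = 0"
        using U weight(1) by (subst (asm) AE_iff_measurable[of U]) (auto simp: W)
      then show False using that by simp
    qed
    have "0 < emeasure (weight V) UNIV"
      using ne weight(2) by (simp add: mass_def zero_less_iff_neq_zero)
    then obtain y0 where "y0 \<in> Z" using ex_Z[of UNIV] by auto
    from Z_ineq[OF this] have "real k * ?w \<le> real k * measure V (space V)"
      using perp_nonneg[of y0] by (smt (verit) mult_nonneg_nonneg of_nat_0_le_iff powr_ge_zero)
    then have le: "?w \<le> measure V (space V)" using k by simp
    have "\<exists>P. subspace P \<and> dim P = k \<and> ?Y \<subseteq> P" if eq: "mass V = ennreal ?w"
    proof (rule subset_subspace_of_ae[OF ne supp])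
      have "measure V (space V) = ?w" using eq mass by simp
      have perp: "AE p in V. fst p - y \<in> snd p" if "y \<in> Z" for y
      proof -
        have "real k * 4 powr (- real k / 2 - 1) * (\<integral>p. perp_sq y p \<partial>V) \<le> 0"
          using Z_ineq[OF that] \<open>measure V (space V) = ?w\<close> by simp
        then have "(\<integral>p. perp_sq y p \<partial>V) = 0"
          using perp_nonneg[of y] k by (simp add: mult_le_0_iff)
        then have "AE p in V. perp_sq y p = 0"
          using integrable_perp_sq by (subst (asm) integral_nonneg_eq_0_iff_AE) (auto simp: perp_sq_def)
        moreover have "AE p in V. p \<in> space V" by simp
        ultimately show ?thesis
        proof eventually_elim
          case (elim p)
          then have S: "snd p \<in> grassmannian k" by (auto simp: space_V)
          have "fst p - y = plane_projection (snd p) (fst p - y)" using elim by (simp add: perp_sq_def)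
          then show ?case using plane_projection_mem[OF S, of "fst p - y"] by simp
        qed
      qed
      \<comment> \<open>The exceptional null set depends on the centre, so only countably many
        centres can be treated at once. Closedness of the planes then extends the relation to the
        closure of \<open>D\<close>, which contains the support.\<close>
      obtain D where D: "countable D" "D \<subseteq> Z" "Z \<subseteq> closure D" using separable by blast
      have "?Y \<subseteq> closure Z"
        unfolding closure_approachable subset_iff measure_support_def
        using ex_Z[OF open_ball] by (auto simp: dist_commute)
      then have YD: "?Y \<subseteq> closure D" using D(3) closure_minimal by blast
      have "AE p in V. \<forall>y\<in>D. fst p - y \<in> snd p"
        using D perp by (simp add: AE_ball_countable subset_iff)
      moreover have "AE p in V. p \<in> space V" by simp
      ultimately show "AE p in V. \<forall>z\<in>?Y. fst p - z \<in> snd p"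
      proof eventually_elim
        case (elim p)
        then have "subspace (snd p)" by (auto simp: space_V grassmannian_def)
        then have "closed ((\<lambda>z. fst p - z) -` snd p)"
          by (intro closed_vimage closed_subspace continuous_intros)
        then have "closure D \<subseteq> (\<lambda>z. fst p - z) -` snd p"
          using elim by (intro closure_minimal) auto
        then show ?case using YD by auto
      qed
    qed
    then show ?thesis using le mass by (simp add: ennreal_leI)
  qed
qed

end
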